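(* Let $\Gamma=(V,E)$ be a distance-biregular graph with diameter $d$, girth $2d-2$, and with two distinct eccentricities (that is, the eccentricities of the vertices of $\Gamma$ take two distinct values). Then $d$ is even, and either $4\le d\le 26$ or $d\in\{48,50\}$.
   Context: All graphs are finite, undirected and simple. For a connected graph $\Gamma$ and a vertex $u$, $\Gamma_i(u)$ is the set of vertices at distance $i$ from $u$; the eccentricity $\varepsilon(u)$ is the maximum distance from $u$ to another vertex; the diameter is the maximum eccentricity; the girth is the minimum length of a cycle. A connected bipartite graph with (non-empty) bipartition classes $A$ and $B$ is distance-biregular if, for every vertex $u$, every $0\le i\le \varepsilon(u)$ and every $v\in\Gamma_i(u)$, the numbers $|\Gamma_{i+1}(u)\cap\Gamma_1(v)|$ and $|\Gamma_{i-1}(u)\cap\Gamma_1(v)|$ depend only on $i$ and on which of the classes $A$, $B$ contains $u$ (not on the choice of $u$ in its class nor on $v\in\Gamma_i(u)$). In particular all vertices in the same class have the same eccentricity. *)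

theory Defs
  imports "Graph_Theory.Digraph_Component" "Graph_Theory.Pair_Digraph" "HOL-Library.Extended_Nat"
begin

text \<open>
  Finite simple undirected graphs are represented by \<^locale>\<open>pair_graph\<close>: an edge between
  \<open>u\<close> and \<open>v\<close> is the pair of opposite arcs \<open>(u, v)\<close> and \<open>(v, u)\<close>. A graph \<open>G\<close> is coerced along
  \<^const>\<open>with_proj\<close> where a general digraph is expected.
\<close>

text \<open>Only meaningful when \<open>v\<close> is reachable from \<open>u\<close>, as is the case in a connected graph.\<close>
definition distance :: "'a pair_pre_digraph \<Rightarrow> 'a \<Rightarrow> 'a \<Rightarrow> nat" where
  "distance G u v = (LEAST n. \<exists>p. pre_digraph.awalk (with_proj G) u p v \<and> length p = n)"

definition sphere :: "'a pair_pre_digraph \<Rightarrow> nat \<Rightarrow> 'a \<Rightarrow> 'a set" where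
  "sphere G i u = {v \<in> pverts G. distance G u v = i}"

definition eccentricity :: "'a pair_pre_digraph \<Rightarrow> 'a \<Rightarrow> nat" where
  "eccentricity G u = Max (distance G u ` pverts G)"

definition diameter :: "'a pair_pre_digraph \<Rightarrow> nat" where
  "diameter G = Max (eccentricity G ` pverts G)"

text \<open>
  \<^const>\<open>pre_digraph.cycle\<close> also admits the closed walk of length 2 that traverses one edge back
  and forth; the bound on the length excludes it. The girth of an acyclic graph is \<open>\<infinity>\<close>.
\<close>
definition girth :: "'a pair_pre_digraph \<Rightarrow> enat" where
  "girth G = (INF p \<in> {p. pre_digraph.cycle (with_proj G) p \<and> 3 \<le> length p}. enat (length p))"

definition bipartition :: "'a pair_pre_digraph \<Rightarrow> 'a set \<Rightarrow> 'a set \<Rightarrow> bool" where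
  "bipartition G A B \<longleftrightarrow> A \<noteq> {} \<and> B \<noteq> {} \<and> A \<inter> B = {} \<and> A \<union> B = pverts G \<and>
     parcs G \<subseteq> A \<times> B \<union> B \<times> A"

text \<open>
  The functions \<open>b\<close> and \<open>c\<close> express that the two numbers depend only on the class \<open>X\<close> of \<open>u\<close> and
  on \<open>i\<close>. For \<open>i = 0\<close> truncated subtraction is harmless: then \<open>v = u\<close>, and
  \<open>sphere G 0 u \<inter> sphere G 1 u\<close> is empty, like the sphere of radius \<open>-1\<close>.
\<close>
definition distance_biregular :: "'a pair_pre_digraph \<Rightarrow> bool" where
  "distance_biregular G \<longleftrightarrow> pair_graph G \<and> Digraph_Component.connected (with_proj G) \<and>
     (\<exists>A B. bipartition G A B \<and>
       (\<exists>b c :: 'a set \<Rightarrow> nat \<Rightarrow> nat.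
         \<forall>X \<in> {A, B}. \<forall>u \<in> X. \<forall>i \<le> eccentricity G u. \<forall>v \<in> sphere G i u.
           card (sphere G (i + 1) u \<inter> sphere G 1 v) = b X i \<and>
           card (sphere G (i - 1) u \<inter> sphere G 1 v) = c X i))"

end

theory Submission
  imports Defs "Jordan_Normal_Form.Schur_Decomposition" "HOL-Library.Z2"
begin

text \<open>
  Two vertices at distance \<open>d\<close> lie in the same class \<open>Q\<close>, the one of eccentricity \<open>d\<close>, so \<open>d = 2D + 2\<close>
  is even. Let \<open>s + 1\<close> and \<open>t + 1\<close> be the valencies on \<open>Q\<close> and on the other class \<open>P\<close>.
  On \<open>P\<close> the girth makes collinearity a distance-regular graph of diameter
  \<open>D\<close> (a Moore geometry). After subtracting \<open>s - 1\<close>, its eigenvalues other than the valency are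
  the roots of \<open>W\<^sub>D + s W\<^sub>D\<^sub>-\<^sub>1\<close>, where \<open>W\<^sub>k\<close> is the Chebyshev polynomial \<open>U\<^sub>k\<close> rescaled to
  the interval \<open>\<bar>w\<bar> \<le> 2 sqrt (s t)\<close>, and the multiplicity of \<open>w\<close> is a quotient of two
  quadratic polynomials in \<open>w\<close>. It is an integer, so every eigenvalue has degree at most 2 over the rationals.

  With \<open>Y = w\<^sup>2 / (s t)\<close> and \<open>q\<^sub>k (Y) = U\<^sub>k\<^sub>-\<^sub>1 (sqrt Y / 2)\<^sup>2\<close>, the integer polynomial
  \<open>t' q\<^sub>D\<^sub>+\<^sub>1 - s' q\<^sub>D\<close> therefore splits over the integers into factors of degree at most 2, where
  \<open>s' / t'\<close> is \<open>s / t\<close> in lowest terms. Modulo 2 the \<open>q\<^sub>k\<close> are the Fibonacci polynomials, and only the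
  irreducible polynomials \<open>Y\<close>, \<open>Y + 1\<close> and \<open>Y\<^sup>2 + Y + 1\<close> may occur. So \<open>D \<le> 2\<close> if \<open>s'\<close> and \<open>t'\<close> are odd, and
  otherwise \<open>D\<close> or \<open>D + 1\<close> is \<open>2\<^sup>e c\<close> with \<open>c\<close> in \<open>{1, 3, 5}\<close>. The 2-adic values at \<open>Y = 0\<close> and \<open>Y = 4\<close> give
  \<open>e \<le> 2\<close>, and the roots reducing to those of \<open>Y\<^sup>2 + Y + 1\<close> rule out 20. Hence \<open>D \<le> 12\<close>, that is \<open>d \<le> 26\<close>.
\<close>

section \<open>Squares of Chebyshev polynomials modulo 2\<close>

text \<open>\<open>chebsq k\<close> is \<open>U\<^sub>k\<^sub>-\<^sub>1 (y / 2)\<^sup>2\<close> as a polynomial in \<open>y\<^sup>2\<close>.\<close>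
fun chebsq :: "nat \<Rightarrow> int poly" where
  "chebsq 0 = 0"
| "chebsq (Suc 0) = 1"
| "chebsq (Suc (Suc n)) = [:-2, 1:] * chebsq (Suc n) - chebsq n + 2"

text \<open>\<open>Y = 4\<close> corresponds to \<open>y = 2\<close>, and
  \<open>U\<^sub>n\<^sub>-\<^sub>1 (1) = n\<close>. With the value at \<open>Y = 0\<close> it gives
  the 2-adic bound on the index.\<close>

lemma poly_chebsq_four: "poly (chebsq n) 4 = (int n)\<^sup>2"
  by (induction n rule: chebsq.induct) (auto simp: algebra_simps power2_eq_square)

lemma poly_chebsq_zero: "poly (chebsq n) 0 = (if even n then 0 else 1)"
  by (induction n rule: chebsq.induct) auto

section \<open>Reduction modulo 2\<close>

definition mod2 :: "int poly \<Rightarrow> bit poly" where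
  "mod2 p = map_poly of_int p"

lemma coeff_mod2 [simp]: "coeff (mod2 p) i = of_int (coeff p i)"
  by (simp add: mod2_def coeff_map_poly)

lemma mod2_0 [simp]: "mod2 0 = 0" and mod2_1 [simp]: "mod2 1 = 1"
  by (simp_all add: mod2_def)

lemma mod2_add [simp]: "mod2 (p + q) = mod2 p + mod2 q"
  by (rule poly_eqI) simp

lemma mod2_diff [simp]: "mod2 (p - q) = mod2 p - mod2 q"
  by (rule poly_eqI) (simp del: minus_bit_def)

lemma mod2_mult [simp]: "mod2 (p * q) = mod2 p * mod2 q"
  by (rule poly_eqI) (simp add: coeff_mult)

lemma mod2_pCons [simp]: "mod2 (pCons a p) = pCons (of_int a) (mod2 p)"
  by (rule poly_eqI) (simp add: coeff_pCons split: nat.split)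

lemma mod2_smult: "mod2 (Polynomial.smult a p) = Polynomial.smult (of_int a) (mod2 p)"
  by (rule poly_eqI) simp

lemma of_int_bit_iff [simp]: "(of_int a :: bit) = 0 \<longleftrightarrow> even a"
proof (cases "even a")
  case True
  then obtain k where "a = 2 * k" by blast
  then show ?thesis by simp
next
  case False
  then obtain k where "a = 2 * k + 1" by (auto elim: oddE)
  then show ?thesis by simp
qed

lemma of_int_bit_eq_1_iff [simp]: "(of_int a :: bit) = 1 \<longleftrightarrow> odd a"
  using of_int_bit_iff [of a] by (simp flip: bit_not_zero_iff del: of_int_bit_iff)

lemma mod2_smult_even [simp]: "even a \<Longrightarrow> mod2 (Polynomial.smult a p) = 0"
  by (rule poly_eqI) simp

lemma mod2_smult_odd [simp]: "odd a \<Longrightarrow> mod2 (Polynomial.smult a p) = mod2 p"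
  by (simp only: mod2_smult smult_1_left flip: of_int_bit_eq_1_iff)

lemma bit_poly_two [simp]: "(2 :: bit poly) = 0"
proof -
  have "(2 :: bit poly) = [:1 + 1:]" by (metis one_add_one one_pCons add_pCons add_0)
  then show ?thesis by simp
qed

lemma bit_poly_double [simp]: "p + p = (0 :: bit poly)"
  by (simp only: mult_2 [symmetric] bit_poly_two mult_zero_left)

lemma bit_poly_diff: "p - q = p + (q :: bit poly)"
  by (rule poly_eqI) simp

lemma bit_poly_square_add: "(p + q)\<^sup>2 = p\<^sup>2 + (q :: bit poly)\<^sup>2"
proof -
  have "(p + q)\<^sup>2 = p\<^sup>2 + q\<^sup>2 + 2 * p * q"
    by (rule power2_sum)
  then show ?thesis by simp
qed

section \<open>Fibonacci polynomials over the field with two elements\<close>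

fun fib2 :: "nat \<Rightarrow> bit poly" where
  "fib2 0 = 0"
| "fib2 (Suc 0) = 1"
| "fib2 (Suc (Suc n)) = [:0, 1:] * fib2 (Suc n) + fib2 n"

lemma mod2_chebsq: "mod2 (chebsq n) = fib2 n"
proof (induction n rule: chebsq.induct)
  case (3 n)
  have "mod2 2 = mod2 1 + mod2 1" by (simp only: mod2_add [symmetric] one_add_one)
  then show ?case using 3 by (simp add: bit_poly_diff)
qed auto

text \<open>The usual doubling formulas, with the mixed terms removed by characteristic 2. They
  reduce the factorization of \<open>fib2 n\<close> to the odd part of \<open>n\<close>.\<close>

lemma fib2_double:
  "fib2 (2 * n) = [:0, 1:] * (fib2 n)\<^sup>2 \<and> fib2 (Suc (2 * n)) = (fib2 (Suc n) + fib2 n)\<^sup>2"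
proof (induction n)
  case (Suc n)
  let ?X = "[:0, 1:] :: bit poly"
  have a: "fib2 (2 * Suc n) = ?X * (fib2 (Suc n))\<^sup>2"
  proof -
    have "fib2 (2 * Suc n) = ?X * fib2 (Suc (2 * n)) + fib2 (2 * n)" by simp
    also have "\<dots> = ?X * (fib2 (Suc n))\<^sup>2 + (?X * (fib2 n)\<^sup>2 + ?X * (fib2 n)\<^sup>2)"
      using Suc by (simp only: bit_poly_square_add distrib_left add.assoc)
    finally show ?thesis by (simp only: bit_poly_double add_0_right)
  qed
  have "fib2 (Suc (2 * Suc n)) = ?X * fib2 (2 * Suc n) + fib2 (Suc (2 * n))" by simp
  also have "\<dots> = (?X * fib2 (Suc n))\<^sup>2 + (fib2 (Suc n))\<^sup>2 + (fib2 n)\<^sup>2"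
    using Suc by (simp only: a bit_poly_square_add power_mult_distrib) (simp only: power2_eq_square ac_simps)
  also have "\<dots> = (?X * fib2 (Suc n) + fib2 n)\<^sup>2 + (fib2 (Suc n))\<^sup>2"
    by (simp only: bit_poly_square_add ac_simps)
  also have "\<dots> = (fib2 (Suc (Suc n)) + fib2 (Suc n))\<^sup>2"
    by (simp only: bit_poly_square_add fib2.simps)
  finally show ?case using a by blast
qed simp

text \<open>By \<open>fib2_double\<close> this is the square root of
  \<open>fib2 (2 * k + 1)\<close>. It is also the reduction of a combination of
  \<open>chebsq (Suc k)\<close> and \<open>chebsq k\<close> with two odd coefficients.\<close>

definition fibsum2 :: "nat \<Rightarrow> bit poly" where
  "fibsum2 k = fib2 (Suc k) + fib2 k"

lemma degree_fib2: "degree (fib2 (Suc k)) = k \<and> degree (fib2 k) \<le> k - 1 \<and> fib2 (Suc k) \<noteq> 0"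
proof (induction k)
  case (Suc k)
  then have d: "degree ([:0, 1:] * fib2 (Suc k)) = Suc k"
    by (simp add: degree_mult_eq)
  moreover have "degree (fib2 k) < Suc k" using Suc by linarith
  ultimately have "degree (fib2 (Suc (Suc k))) = Suc k"
    unfolding fib2.simps by (subst degree_add_eq_left) auto
  then show ?case using Suc by (metis diff_Suc_1 degree_0 le_refl nat.distinct(1))
qed auto

lemma fib2_nonzero: "n > 0 \<Longrightarrow> fib2 n \<noteq> 0"
  using degree_fib2 by (cases n) auto

lemma degree_fibsum2: "degree (fibsum2 k) = k"
  using degree_fib2 [of k]
  by (cases k) (auto simp: fibsum2_def degree_add_eq_left)

lemma poly_fib2_zero: "poly (fib2 n) 0 = (if even n then 0 else 1)"
  by (induction n rule: fib2.induct) auto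

lemma poly_fibsum2_zero: "poly (fibsum2 k) 0 = 1"
  by (auto simp: fibsum2_def poly_fib2_zero)

lemma of_nat_bit_poly: "(of_nat n :: bit poly) = (if even n then 0 else 1)"
  by (induction n) auto

text \<open>The derivative exhibits every multiple factor of \<open>fibsum2 k\<close> as a common factor of two
  consecutive Fibonacci polynomials.\<close>
lemma pderiv_fib2: "[:0, 1:] * pderiv (fib2 n) = of_nat (Suc n) * fib2 n"
proof (induction n rule: fib2.induct)
  case (3 n)
  let ?X = "[:0, 1:] :: bit poly"
  have "?X * pderiv (fib2 (Suc (Suc n)))
      = ?X * fib2 (Suc n) + ?X * (?X * pderiv (fib2 (Suc n))) + ?X * pderiv (fib2 n)"
    by (simp only: fib2.simps pderiv_add pderiv_mult)
       (simp add: pderiv_pCons algebra_simps)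
  also have "\<dots> = ?X * fib2 (Suc n) + ?X * (of_nat (Suc (Suc n)) * fib2 (Suc n)) + of_nat (Suc n) * fib2 n"
    by (simp only: 3)
  also have "\<dots> = of_nat (Suc (Suc (Suc n))) * fib2 (Suc (Suc n))"
    by (simp add: of_nat_bit_poly)
  finally show ?case .
qed auto

text \<open>Running the recurrence backwards carries a common divisor down to
  \<open>fib2 1 = 1\<close>.\<close>

lemma consecutive_fib2_coprime:
  assumes "a dvd fib2 (Suc n)" "a dvd fib2 n" shows "a dvd 1"
  using assms
proof (induction n)
  case (Suc n)
  have "fib2 n = fib2 (Suc (Suc n)) + [:0, 1:] * fib2 (Suc n)" by (simp add: ac_simps)
  then have "a dvd fib2 n" using Suc.prems by (metis dvd_add dvd_mult)
  then show ?case using Suc by blast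
qed auto

lemma fibsum2_squarefree:
  assumes "a\<^sup>2 dvd fibsum2 k" shows "a dvd 1"
proof -
  let ?X = "[:0, 1:] :: bit poly"
  obtain h where h: "fibsum2 k = a * (a * h)"
    using assms unfolding power2_eq_square dvd_def by (auto simp: mult.assoc)
  have a: "a dvd fib2 (Suc k) + fib2 k" using h by (simp add: fibsum2_def)
  have "a dvd pderiv (fibsum2 k)" unfolding h pderiv_mult [of a "a * h"] by simp
  then have "a dvd ?X * pderiv (fibsum2 k)" by (rule dvd_mult)
  \<comment> \<open>Exactly one of the coefficients \<open>k + 1\<close> and \<open>k + 2\<close> is
    odd, so a single Fibonacci polynomial survives; subtracting it from \<open>fibsum2 k\<close>
    gives the other one.\<close>
  also have "?X * pderiv (fibsum2 k) = (if even k then fib2 k else fib2 (Suc k))"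
    unfolding fibsum2_def pderiv_add distrib_left pderiv_fib2 by (simp add: of_nat_bit_poly)
  finally have d: "a dvd (if even k then fib2 k else fib2 (Suc k))" .
  show ?thesis
  proof (cases "even k")
    case True
    then have "a dvd fib2 k" using d by simp
    moreover from this a have "a dvd fib2 (Suc k)" by (simp add: dvd_add_left_iff)
    ultimately show ?thesis by (rule consecutive_fib2_coprime [rotated])
  next
    case False
    then have "a dvd fib2 (Suc k)" using d by simp
    moreover from this a have "a dvd fib2 k" by (simp add: dvd_add_right_iff)
    ultimately show ?thesis by (rule consecutive_fib2_coprime)
  qed
qed

section \<open>Integer polynomials with factors of degree at most 2\<close>

lemma bit_poly_degree_2_cases:
  fixes f :: "bit poly"
  assumes "degree f \<le> 2"
  obtains a b c where "f = [:a, b, c:]"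
proof -
  have "f = [:coeff f 0, coeff f 1, coeff f 2:]"
    using assms by (intro poly_eqI) (auto simp: coeff_pCons coeff_eq_0 numeral_2_eq_2 split: nat.split)
  then show ?thesis by (rule that)
qed

abbreviation (input) bX :: "bit poly" where "bX \<equiv> [:0, 1:]"
abbreviation (input) bX1 :: "bit poly" where "bX1 \<equiv> [:1, 1:]"
abbreviation (input) bC :: "bit poly" where "bC \<equiv> [:1, 1, 1:]"

lemma prime_elem_linear_poly: "prime_elem [:- a, 1 :: 'a :: field:]"
proof (rule prime_elemI)
  fix p q :: "'a poly"
  assume "[:- a, 1:] dvd p * q"
  then show "[:- a, 1:] dvd p \<or> [:- a, 1:] dvd q"
    by (simp flip: poly_eq_0_iff_dvd)
qed (auto simp: is_unit_iff_degree)

lemma prime_bX: "prime_elem bX" and prime_bX1: "prime_elem bX1"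
  using prime_elem_linear_poly [of "0 :: bit"] prime_elem_linear_poly [of "1 :: bit"] by simp_all

lemma is_unit_bit_poly_iff: "(p :: bit poly) dvd 1 \<longleftrightarrow> p = 1"
proof
  assume p: "p dvd 1"
  then have "p \<noteq> 0" by auto
  moreover from this p have "degree p = 0" using is_unit_iff_degree by blast
  ultimately obtain c where "p = [:c:]" "c \<noteq> 0" by (auto elim: degree_eq_zeroE)
  then show "p = 1" by simp
qed simp

lemma prime_bC: "prime_elem bC"
proof (intro field_poly_irreducible_imp_prime irreducibleI)
  fix p q :: "bit poly"
  assume pq: "bC = p * q"
  then have ne: "p \<noteq> 0" "q \<noteq> 0" by auto
  then have deg: "degree p + degree q = 2"
    using arg_cong [OF pq, of degree] by (simp add: degree_mult_eq)
  show "p dvd 1 \<or> q dvd 1"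
  proof (rule ccontr)
    assume "\<not> ?thesis"
    then have "degree p \<noteq> 0" "degree q \<noteq> 0" using ne is_unit_iff_degree by blast+
    with deg have "degree p = 1" "degree q = 1" by auto
    then obtain a b c d where "p = [:a, b:]" "q = [:c, d:]"
      by (metis degree1_coeffs)
    with pq show False by (cases a; cases b; cases c; cases d) auto
  qed
qed (auto simp: is_unit_iff_degree)

text \<open>The square condition remembers that the roots are \<open>w\<^sup>2 / n\<close> with \<open>w\<close> of degree at most 2.\<close>
inductive quadratic_split :: "int poly \<Rightarrow> bool" where
  const: "c \<noteq> 0 \<Longrightarrow> quadratic_split [:c:]"
| mult: "quadratic_split P \<Longrightarrow> f \<noteq> 0 \<Longrightarrow> degree f \<le> 2 \<Longrightarrow>
    (degree f = 2 \<Longrightarrow> \<exists>z. coeff f 0 * coeff f 2 = z\<^sup>2) \<Longrightarrow> quadratic_split (f * P)"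

lemma degree_mod2_le: "degree (mod2 f) \<le> degree f"
  by (rule degree_le) (simp add: coeff_eq_0)

lemma prime_elem_dvd_mult_cancel:
  fixes p g m :: "'a :: idom"
  assumes "prime_elem p" "\<not> p dvd g" "g dvd p * m"
  shows "g dvd m"
proof -
  obtain h where h: "p * m = g * h" using assms(3) unfolding dvd_def by blast
  then have "p dvd h" using assms(1,2) by (metis dvd_triv_left prime_elem_dvd_mult_iff)
  then obtain h' where "h = p * h'" unfolding dvd_def by blast
  then have "p * m = p * (g * h')" using h by (simp add: ac_simps)
  then show ?thesis using assms(1) by (auto dest: prime_elem_not_zeroI)
qed

lemma bit_poly_two_factors:
  assumes "degree f \<le> 2" "f \<noteq> 0"
  shows "f \<in> {1, bX, bX1, bX * bX, bX * bX1, bX1 * bX1, bC}"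
proof -
  obtain a b c where "f = [:a, b, c:]" using assms(1) by (rule bit_poly_degree_2_cases)
  with assms(2) show ?thesis
    by (cases a; cases b; cases c) (auto simp: one_pCons)
qed

text \<open>Reduction does not raise degrees, so \<open>mod2 P\<close> is a product of members of
  the list in \<open>bit_poly_two_factors\<close>, whose only prime factors are \<open>bX\<close>,
  \<open>bX1\<close> and \<open>bC\<close>.\<close>

lemma quadratic_split_mod2_unit:
  assumes "quadratic_split P" "mod2 P \<noteq> 0" "g dvd mod2 P"
    and "\<not> bX dvd g" "\<not> bX1 dvd g" "\<not> bC dvd g"
  shows "g dvd 1"
  using assms
proof (induction rule: quadratic_split.induct)
  case (const c)
  then have "odd c" by auto
  then have "mod2 [:c:] = 1" by (simp add: one_pCons)
  then show ?case using const by simp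
next
  case (mult P f)
  have ne: "mod2 f \<noteq> 0" "mod2 P \<noteq> 0" using mult.prems(1) by auto
  have "degree (mod2 f) \<le> 2" using degree_mod2_le mult.hyps(3) by (rule le_trans)
  then have "mod2 f \<in> {1, bX, bX1, bX * bX, bX * bX1, bX1 * bX1, bC}"
    using ne(1) by (rule bit_poly_two_factors)
  moreover have "g dvd mod2 f * mod2 P" using mult.prems by simp
  moreover have "g dvd m" if F: "F \<in> {1, bX, bX1, bX * bX, bX * bX1, bX1 * bX1, bC}" and "g dvd F * m" for F m
  proof -
    note strip = prime_elem_dvd_mult_cancel [OF prime_bX mult.prems(3)]
      prime_elem_dvd_mult_cancel [OF prime_bX1 mult.prems(4)]
      prime_elem_dvd_mult_cancel [OF prime_bC mult.prems(5)]
    consider "g dvd m" | "g dvd bX * m" | "g dvd bX1 * m" | "g dvd bX * (bX * m)"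
      | "g dvd bX * (bX1 * m)" | "g dvd bX1 * (bX1 * m)" | "g dvd bC * m"
      using F \<open>g dvd F * m\<close> by (elim insertE emptyE) (simp_all only: mult.assoc mult_1_left)
    then show ?thesis by cases (blast dest: strip)+
  qed
  ultimately have "g dvd mod2 P" by blast
  then show ?case using mult.IH ne(2) mult.prems by blast
qed

lemma squarefree_prime_cases:
  fixes g p :: "bit poly"
  assumes "prime_elem p" and sq: "\<And>a. a\<^sup>2 dvd g \<Longrightarrow> a dvd 1"
  obtains e h where "e \<in> {1, p}" "g = e * h" "\<not> p dvd h"
proof (cases "p dvd g")
  case True
  then obtain h where h: "g = p * h" unfolding dvd_def by blast
  have "\<not> p dvd h"
  proof
    assume "p dvd h"
    then have "p\<^sup>2 dvd g" unfolding h power2_eq_square by (simp add: mult_dvd_mono)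
    then show False using sq assms(1) by (auto dest: prime_elem_not_unit)
  qed
  then show ?thesis using that [of p h] h by simp
next
  case False
  then show ?thesis using that [of 1 g] by simp
qed

text \<open>\<open>fibsum2 k\<close> is squarefree with constant term 1, so it divides
  \<open>bX1 * bC\<close>, and its degree is \<open>k\<close>.\<close>

lemma fibsum2_dvd_quadratic_split:
  assumes "quadratic_split P" "mod2 P \<noteq> 0" "fibsum2 k dvd mod2 P"
  shows "k \<le> 2"
proof -
  have x: "\<not> bX dvd fibsum2 k"
    using poly_fibsum2_zero [of k] poly_eq_0_iff_dvd [of "fibsum2 k" 0] by simp
  obtain e h where e: "e \<in> {1, bX1}" "fibsum2 k = e * h" "\<not> bX1 dvd h"
    using squarefree_prime_cases [OF prime_bX1 fibsum2_squarefree] .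
  have "\<And>a. a\<^sup>2 dvd h \<Longrightarrow> a dvd 1"
    using fibsum2_squarefree e(2) by (metis dvd_mult)
  then obtain e' h' where e': "e' \<in> {1, bC}" "h = e' * h'" "\<not> bC dvd h'"
    by (rule squarefree_prime_cases [OF prime_bC])
  have "h' dvd h" "h dvd fibsum2 k" using e(2) e'(2) by simp_all
  then have "\<not> bX dvd h'" "\<not> bX1 dvd h'" "h' dvd mod2 P"
    using x e(3) assms(3) by (meson dvd_trans)+
  then have "h' dvd 1" using quadratic_split_mod2_unit [OF assms(1,2)] e'(3) by blast
  then have "h' = 1" by (simp only: is_unit_bit_poly_iff)
  then have "fibsum2 k = e * e'" using e(2) e'(2) by simp
  then consider "fibsum2 k = 1" | "fibsum2 k = bX1" | "fibsum2 k = bC" | "fibsum2 k = bX1 * bC"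
    using e(1) e'(1) by auto
  then show ?thesis
  proof cases
    \<comment> \<open>Degrees alone leave \<open>k = 3\<close> open: \<open>fibsum2 3\<close> is
      \<open>X^3 + X^2 + 1\<close>, while \<open>bX1 * bC\<close> is \<open>X^3 + 1\<close>.\<close>
    case 4
    then have "k = 3" using degree_fibsum2 [of k] by simp
    then have "fibsum2 k = [:1, 0, 1, 1:]"
      by (simp add: fibsum2_def numeral_3_eq_3 one_pCons)
    with 4 show ?thesis by simp
  qed (use degree_fibsum2 [of k] in auto)
qed

text \<open>For a quadratic factor congruent to \<open>Y\<^sup>2\<close>, divisibility of the values by 4 and not just by 2 is due to
  the square condition.\<close>
lemma quadratic_split_order:
  assumes "quadratic_split P" "mod2 P \<noteq> 0"
  shows "2 ^ Polynomial.order 0 (mod2 P) dvd poly P 0 \<and> 2 ^ Polynomial.order 0 (mod2 P) dvd poly P 4"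
  using assms
proof (induction rule: quadratic_split.induct)
  case (const c)
  then have "mod2 [:c:] = 1" by (auto simp: one_pCons)
  then show ?case by simp
next
  case (mult P f)
  have ne: "mod2 f \<noteq> 0" "mod2 P \<noteq> 0" using mult.prems(1) by auto
  let ?m = "Polynomial.order 0 (mod2 f)"
  define a b c where "a = coeff f 0" "b = coeff f 1" "c = coeff f 2"
  have f: "f = [:a, b, c:]"
    using mult.hyps(3) unfolding a_b_c_def
    by (intro poly_eqI) (auto simp: coeff_pCons coeff_eq_0 numeral_2_eq_2 split: nat.split)
  have "?m \<le> degree (mod2 f)" by (rule order_degree [OF ne(1)])
  also have "\<dots> \<le> 2" using degree_mod2_le mult.hyps(3) by (rule le_trans)
  finally have m: "?m \<le> 2" .
  have dvd: "bX ^ ?m dvd mod2 f" using order_1 [of 0 "mod2 f"] by simp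
  have "2 ^ ?m dvd poly f 0 \<and> 2 ^ ?m dvd poly f 4"
  proof -
    consider "?m = 0" | "?m = 1" | "?m = 2" using m by linarith
    then show ?thesis
    proof cases
      case 2
      then have "even a" using dvd poly_eq_0_iff_dvd [of "mod2 f" 0] unfolding f by simp
      then show ?thesis using 2 by (simp add: f)
    next
      case 3
      then obtain h where h: "mod2 f = bX * (bX * h)"
        using dvd unfolding 3 power2_eq_square dvd_def mult.assoc by blast
      have ab: "even a" "even b" using h unfolding f by auto
      then have "odd c" using ne(1) unfolding f by auto
      then have "degree f = 2" unfolding f by auto
      then obtain z where z: "a * c = z\<^sup>2" using mult.hyps(4) by (auto simp: a_b_c_def)
      then have "even z" using ab(1) by (metis even_mult_iff even_power zero_less_numeral)
      then have "2\<^sup>2 dvd a * c" unfolding z by (rule dvd_power_same)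
      moreover have "coprime (2\<^sup>2) c" using \<open>odd c\<close> by (subst coprime_power_left_iff) simp
      ultimately have "4 dvd a" by (simp add: coprime_dvd_mult_left_iff)
      then show ?thesis using 3 by (simp add: f)
    qed simp
  qed
  then show ?case
    using mult.IH ne by (simp add: order_mult power_add mult_dvd_mono)
qed

section \<open>Congruences modulo a monic quadratic polynomial\<close>

lemma monic_quadratic_remainder:
  fixes b0 b1 :: int
  shows "\<exists>u v. [:b0, b1, 1:] dvd h - [:u, v:]"
proof (induction h)
  case 0
  have "[:b0, b1, 1:] dvd 0 - [:0, 0:]" by simp
  then show ?case by blast
next
  case (pCons a h)
  then obtain u v where "[:b0, b1, 1:] dvd h - [:u, v:]" by blast
  then have "[:b0, b1, 1:] dvd [:0, 1:] * (h - [:u, v:]) + Polynomial.smult v [:b0, b1, 1:]"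
    by (intro dvd_add dvd_mult dvd_smult) auto
  also have "[:0, 1:] * (h - [:u, v:]) + Polynomial.smult v [:b0, b1, 1:]
      = pCons a h - [:a - v * b0, u - v * b1:]"
    by (intro poly_eqI) (auto simp: coeff_pCons split: nat.split)
  finally show ?case by blast
qed

lemma monic_quadratic_dvd_linear:
  fixes b0 b1 :: int
  assumes "[:b0, b1, 1:] dvd [:u, v:]"
  shows "u = 0 \<and> v = 0"
proof (rule ccontr)
  assume "\<not> ?thesis"
  then have "[:u, v:] \<noteq> 0" by simp
  with assms have "degree [:b0, b1, 1:] \<le> degree [:u, v:]" by (rule dvd_imp_degree_le)
  then show False by (auto split: if_splits)
qed

text \<open>Remainders modulo a monic quadratic are unique over the integers, so divisibility by
  \<open>c\<close> in the quotient ring can be read off the coefficients.\<close>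

lemma monic_quadratic_dvd_linear_cong:
  fixes b0 b1 :: int
  assumes "[:b0, b1, 1:] dvd [:u, v:] - Polynomial.smult c h"
  shows "c dvd u \<and> c dvd v"
proof -
  obtain u' v' where "[:b0, b1, 1:] dvd h - [:u', v':]"
    using monic_quadratic_remainder by blast
  then have "[:b0, b1, 1:] dvd ([:u, v:] - Polynomial.smult c h) + Polynomial.smult c (h - [:u', v':])"
    using assms by (intro dvd_add dvd_smult)
  then have "[:b0, b1, 1:] dvd [:u - c * u', v - c * v':]"
    by (simp add: smult_diff_right)
  from monic_quadratic_dvd_linear [OF this] show ?thesis by auto
qed

text \<open>The monic quadratic reduces to \<open>bC\<close>. A factor of \<open>P\<close> with the
  same reduction is an odd multiple of it plus twice a linear polynomial, and so contributes a
  factor 2 at its roots.\<close>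

lemma quadratic_split_cyclotomic:
  fixes b0 b1 :: int
  assumes "odd b0" "odd b1" "quadratic_split P" "mod2 P \<noteq> 0" "bC ^ m dvd mod2 P"
  shows "\<exists>h. [:b0, b1, 1:] dvd P - Polynomial.smult (2 ^ m) h"
  using assms(3-)
proof (induction arbitrary: m rule: quadratic_split.induct)
  case (const c)
  then have "mod2 [:c:] = 1" by (auto simp: one_pCons)
  then have "bC ^ m dvd 1" using const by (simp only:)
  then have "bC dvd 1 \<or> m = 0" by (simp only: is_unit_power_iff)
  then have "m = 0" using prime_elem_not_unit [OF prime_bC] by blast
  then have "[:b0, b1, 1:] dvd [:c:] - Polynomial.smult (2 ^ m) [:c:]" by simp
  then show ?case by blast
next
  case (mult P f)
  have ne: "mod2 f \<noteq> 0" "mod2 P \<noteq> 0" using mult.prems(1) by auto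
  show ?case
  proof (cases "m > 0 \<and> bC dvd mod2 f")
    case True
    then obtain n where m: "m = Suc n" using gr0_implies_Suc by blast
    obtain a b c where f: "f = [:a, b, c:]"
      using mult.hyps(3) that [of "coeff f 0" "coeff f 1" "coeff f 2"]
      by (auto simp: poly_eq_iff coeff_pCons coeff_eq_0 numeral_2_eq_2 split: nat.split)
    obtain k where k: "mod2 f = bC * k" using True unfolding dvd_def by blast
    have "k \<noteq> 0" using k ne by auto
    then have "degree (mod2 f) = 2 + degree k" unfolding k by (subst degree_mult_eq) auto
    moreover have "degree (mod2 f) \<le> 2" using degree_mod2_le mult.hyps(3) by (rule le_trans)
    ultimately have "degree k = 0" by simp
    then have "k = 1" using \<open>k \<noteq> 0\<close> by (auto simp: one_pCons elim!: degree_eq_zeroE)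
    then have fC: "mod2 f = bC" using k by simp
    then have odd: "odd a" "odd b" "odd c" unfolding f by auto
    have "bC * bC ^ n dvd bC * mod2 P" using mult.prems(2) by (simp add: m fC)
    then have "bC ^ n dvd mod2 P" by (simp only: dvd_mult_cancel_left) simp
    then obtain h where h: "[:b0, b1, 1:] dvd P - Polynomial.smult (2 ^ n) h" using mult.IH ne(2) by blast
    have "even (a - c * b0)" "even (b - c * b1)" using odd assms(1,2) by simp_all
    then obtain x y where xy: "a - c * b0 = 2 * x" "b - c * b1 = 2 * y" unfolding dvd_def by blast
    then have f': "f = Polynomial.smult c [:b0, b1, 1:] + Polynomial.smult 2 [:x, y:]" by (simp add: f algebra_simps)
    \<comment> \<open>Modulo \<open>B\<close> the new factor is \<open>2 * l\<close>, which raises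
      \<open>2 ^ n * h\<close> to \<open>2 ^ Suc n * (l * h)\<close>.\<close>
    have "(Polynomial.smult c B + Polynomial.smult 2 l) * P - Polynomial.smult (2 ^ Suc n) (l * h) =
        B * Polynomial.smult c P + Polynomial.smult 2 l * (P - Polynomial.smult (2 ^ n) h)" for B l
      by (simp add: algebra_simps smult_diff_right)
    from this [of "[:b0, b1, 1:]" "[:x, y:]"]
    have "f * P - Polynomial.smult (2 ^ m) ([:x, y:] * h) =
        [:b0, b1, 1:] * Polynomial.smult c P + Polynomial.smult 2 [:x, y:] * (P - Polynomial.smult (2 ^ n) h)"
      by (simp only: m f')
    then have "[:b0, b1, 1:] dvd f * P - Polynomial.smult (2 ^ m) ([:x, y:] * h)"
      using h by (metis dvd_add dvd_mult dvd_triv_left)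
    then show ?thesis by blast
  next
    case False
    then have "bC ^ m dvd mod2 P"
      using prime_power_dvd_multD [OF prime_bC, of m "mod2 f" "mod2 P"] mult.prems(2)
      by (cases "m = 0") auto
    then obtain h where "[:b0, b1, 1:] dvd P - Polynomial.smult (2 ^ m) h" using mult.IH ne(2) by blast
    then have "[:b0, b1, 1:] dvd f * (P - Polynomial.smult (2 ^ m) h)" by (rule dvd_mult)
    then have "[:b0, b1, 1:] dvd f * P - Polynomial.smult (2 ^ m) (f * h)"
      by (simp add: algebra_simps)
    then show ?thesis by blast
  qed
qed

text \<open>The remainders of two consecutive \<open>chebsq\<close> modulo \<open>Y\<^sup>2 + b1 Y + b0\<close>, as coefficient pairs.\<close>
primrec chebsq_rem :: "int \<Rightarrow> int \<Rightarrow> nat \<Rightarrow> (int \<times> int) \<times> (int \<times> int)" where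
  "chebsq_rem b0 b1 0 = ((0, 0), (1, 0))"
| "chebsq_rem b0 b1 (Suc n) =
    (case chebsq_rem b0 b1 n of ((u, v), (x, y)) \<Rightarrow>
      ((x, y), (- b0 * y - 2 * x - u + 2, x - b1 * y - 2 * y - v)))"

lemma chebsq_rem:
  assumes "chebsq_rem b0 b1 n = ((u, v), (x, y))"
  shows "[:b0, b1, 1:] dvd chebsq n - [:u, v:] \<and> [:b0, b1, 1:] dvd chebsq (Suc n) - [:x, y:]"
  using assms
proof (induction n arbitrary: u v x y)
  case 0
  then show ?case by (simp add: one_pCons)
next
  case (Suc n)
  obtain u' v' x' y' where eq: "chebsq_rem b0 b1 n = ((u', v'), (x', y'))" by (metis surj_pair)
  with Suc.prems have new: "u = x'" "v = y'"
    "x = - b0 * y' - 2 * x' - u' + 2" "y = x' - b1 * y' - 2 * y' - v'" by auto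
  note IH = Suc.IH [OF eq]
  have "[:b0, b1, 1:] dvd [:-2, 1:] * (chebsq (Suc n) - [:x', y':]) - (chebsq n - [:u', v':])
      + Polynomial.smult y' [:b0, b1, 1:]"
    using IH by (metis dvd_add dvd_diff dvd_mult dvd_smult dvd_refl)
  also have "\<dots> = ([:-2, 1:] * chebsq (Suc n) - chebsq n)
      - ([:-2, 1:] * [:x', y':] - [:u', v':] - Polynomial.smult y' [:b0, b1, 1:])"
    by (simp add: right_diff_distrib del: mult_pCons_left mult_pCons_right)
  also have "[:-2, 1:] * [:x', y':] - [:u', v':] - Polynomial.smult y' [:b0, b1, 1:] = [:x, y:] - 2"
    by (simp add: new numeral_poly)
  also have "([:-2, 1:] * chebsq (Suc n) - chebsq n) - ([:x, y:] - 2) = chebsq (Suc (Suc n)) - [:x, y:]"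
    by simp
  finally show ?case using IH new(1,2) by blast
qed

text \<open>The index 20 is the one value above 12 that the other restrictions leave.
  \<open>fib2 5\<close> is \<open>bC\<close> squared, and each of the two doublings doubles the
  exponent.\<close>

lemma fib2_20: "bC ^ 8 dvd fib2 20"
proof -
  have "fib2 5 = bC\<^sup>2"
    using fib2_double [of 2] by (simp add: numeral_2_eq_2 one_pCons eval_nat_numeral)
  moreover have "fib2 10 = bX * (fib2 5)\<^sup>2" "fib2 20 = bX * (fib2 10)\<^sup>2"
    using fib2_double [of 5] fib2_double [of 10] by simp_all
  ultimately have "fib2 20 = bX * (bX * (bC\<^sup>2)\<^sup>2)\<^sup>2" by simp
  moreover have "x * (x * (c\<^sup>2)\<^sup>2)\<^sup>2 = x ^ 3 * c ^ 8" for x c :: "bit poly"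
    by (simp add: power_mult_distrib eval_nat_numeral ac_simps)
  ultimately have "fib2 20 = bX ^ 3 * bC ^ 8" by metis
  then show ?thesis by (metis dvd_triv_right)
qed

text \<open>At the roots of \<open>Y\<^sup>2 - 3 Y + 1\<close> the first term vanishes, hence \<open>2\<^sup>8\<close> divides \<open>\<beta>\<close>. This contradicts the
  value at the roots of \<open>Y\<^sup>2 - Y - 1\<close>, where \<open>chebsq 20\<close> is divisible by \<open>2\<^sup>6\<close> only.\<close>
lemma not_quadratic_split_20:
  assumes "odd \<alpha>" "even \<beta>" "M = 19 \<or> M = 21"
  shows "\<not> quadratic_split (Polynomial.smult \<alpha> (chebsq 20) + Polynomial.smult \<beta> (chebsq M))"
proof
  let ?P = "Polynomial.smult \<alpha> (chebsq 20) + Polynomial.smult \<beta> (chebsq M)"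
  assume split: "quadratic_split ?P"
  have P: "mod2 ?P = fib2 20" using assms by (simp add: mod2_chebsq)
  have ne: "mod2 ?P \<noteq> 0" unfolding P by (rule fib2_nonzero) simp
  have dvd: "bC ^ 8 dvd mod2 ?P" unfolding P by (rule fib2_20)
  \<comment> \<open>The roots are \<open>4 cos^2 (pi/5)\<close> and \<open>4 cos^2 (2 pi/5)\<close>.
    There \<open>chebsq\<close> has period 5, with value 0 at the multiples of 5 and 1 next to
    them.\<close>
  let ?B = "[:1, -3, 1:] :: int poly"
  have r: "chebsq_rem 1 (-3) 19 = ((1, 0), (0, 0))" "chebsq_rem 1 (-3) 20 = ((0, 0), (1, 0))"
    by (simp_all add: eval_nat_numeral)
  have B: "?B dvd chebsq 20" "?B dvd chebsq M - 1"
    using chebsq_rem [OF r(1)] chebsq_rem [OF r(2)] assms(3) by (auto simp: one_pCons)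
  obtain h where h: "?B dvd ?P - Polynomial.smult (2 ^ 8) h"
    using quadratic_split_cyclotomic [of 1 "-3", OF _ _ split ne dvd] by auto
  have "?B dvd (?P - Polynomial.smult (2 ^ 8) h) - Polynomial.smult \<alpha> (chebsq 20) - Polynomial.smult \<beta> (chebsq M - 1)"
    by (rule dvd_diff [OF dvd_diff [OF h dvd_smult [OF B(1)]] dvd_smult [OF B(2)]])
  then have "?B dvd [:\<beta>, 0:] - Polynomial.smult (2 ^ 8) h"
    by (simp add: smult_diff_right one_pCons)
  then have "2 ^ 8 dvd \<beta>" using monic_quadratic_dvd_linear_cong by blast
  then obtain \<beta>' where \<beta>': "\<beta> = 2 ^ 8 * \<beta>'" by (auto elim: dvdE)
  let ?A = "[:-1, -1, 1:] :: int poly"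
  obtain k where k: "?A dvd ?P - Polynomial.smult (2 ^ 8) k"
    using quadratic_split_cyclotomic [of "-1" "-1", OF _ _ split ne dvd] by auto
  obtain x y x' y' where rA: "chebsq_rem (-1) (-1) 20 = ((x, y), (x', y'))" and x: "\<not> 2 ^ 8 dvd x"
    by (simp add: eval_nat_numeral)
  have "?A dvd (?P - Polynomial.smult (2 ^ 8) k) - Polynomial.smult \<alpha> (chebsq 20 - [:x, y:])"
    using k chebsq_rem [OF rA] by (metis dvd_diff dvd_smult)
  \<comment> \<open>\<open>\<beta>\<close> is already a multiple of \<open>2 ^ 8\<close>, so its
    term is absorbed and only the remainder of \<open>chebsq 20\<close> is left.\<close>
  also have "\<dots> = Polynomial.smult \<alpha> [:x, y:] - Polynomial.smult (2 ^ 8) (k - Polynomial.smult \<beta>' (chebsq M))"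
    by (simp add: smult_diff_right \<beta>')
  finally have "2 ^ 8 dvd \<alpha> * x" using monic_quadratic_dvd_linear_cong [of "-1" "-1" "\<alpha> * x" "\<alpha> * y"] by auto
  moreover have "coprime (2 ^ 8) \<alpha>" using assms(1) by (subst coprime_power_left_iff) simp
  ultimately show False using x by (simp add: coprime_dvd_mult_right_iff)
qed

section \<open>Bounding the index\<close>

lemma fibsum2_dvd_fib2: "fibsum2 k dvd fib2 (2 ^ e * (2 * k + 1))"
proof (induction e)
  case 0
  have "fib2 (Suc (2 * k)) = (fibsum2 k)\<^sup>2" using fib2_double [of k] by (simp add: fibsum2_def)
  then show ?case by (simp add: power2_eq_square)
next
  case (Suc e)
  have "fib2 (2 * (2 ^ e * (2 * k + 1))) = bX * (fib2 (2 ^ e * (2 * k + 1)))\<^sup>2"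
    using fib2_double by blast
  then show ?case
    using dvd_trans [OF Suc] by (simp add: power2_eq_square mult.assoc del: mult_pCons_left)
qed

text \<open>At an odd index the value at 0 is nonzero, and each doubling turns an order
  \<open>r\<close> into \<open>2 * r + 1\<close>.\<close>

lemma order_fib2:
  assumes "odd c"
  shows "Polynomial.order 0 (fib2 (2 ^ e * c)) = 2 ^ e - 1"
proof (induction e)
  case 0
  then show ?case using assms poly_fib2_zero [of c] order_root [of "fib2 c" 0] by auto
next
  case (Suc e)
  have c: "c > 0" using assms by (rule odd_pos)
  have "fib2 (2 ^ Suc e * c) = bX * (fib2 (2 ^ e * c) * fib2 (2 ^ e * c))"
    using fib2_double [of "2 ^ e * c"] by (simp add: power2_eq_square mult.assoc)
  moreover have "Polynomial.order 0 bX = 1" using order_power_n_n [of "0 :: bit" 1] by simp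
  moreover have "fib2 (2 ^ e * c) \<noteq> 0" using c by (intro fib2_nonzero) simp
  ultimately have "Polynomial.order 0 (fib2 (2 ^ Suc e * c)) = 1 + (2 ^ e - 1 + (2 ^ e - 1))"
    using Suc by (simp add: order_mult del: mult_pCons_left)
  also have "\<dots> = 2 ^ Suc e - 1" by (simp add: nat_eq_iff) (use one_le_power [of "2::nat" e] in linarith)
  finally show ?case .
qed

text \<open>Modulo 2 only \<open>fib2 N\<close> survives. For \<open>N = 2 ^ e * c\<close> with
  \<open>c\<close> odd, its prime factors bound \<open>c\<close> and its order at 0 bounds
  \<open>e\<close>.\<close>

lemma chebsq_split_even_bound:
  assumes split: "quadratic_split (Polynomial.smult \<alpha> (chebsq N) + Polynomial.smult \<beta> (chebsq M))"
    and "odd \<alpha>" "even \<beta>" "N > 0" "M = Suc N \<or> N = Suc M"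
  shows "N \<le> 12"
proof -
  let ?P = "Polynomial.smult \<alpha> (chebsq N) + Polynomial.smult \<beta> (chebsq M)"
  have P: "mod2 ?P = fib2 N" using assms(2,3) by (simp add: mod2_chebsq)
  have ne: "mod2 ?P \<noteq> 0" unfolding P using \<open>N > 0\<close> by (rule fib2_nonzero)
  obtain c where "N = 2 ^ multiplicity 2 N * c" and c: "odd c"
    using \<open>N > 0\<close> by (auto intro: multiplicity_decompose' [of N 2])
  then obtain e where N: "N = 2 ^ e * c" by blast
  obtain k where k: "c = 2 * k + 1" using c by (auto elim: oddE)
  have "fibsum2 k dvd fib2 N" unfolding N k by (rule fibsum2_dvd_fib2)
  then have "fibsum2 k dvd mod2 ?P" by (simp only: P)
  then have "k \<le> 2" by (rule fibsum2_dvd_quadratic_split [OF split ne])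
  then have c5: "c = 1 \<or> c = 3 \<or> c = 5" unfolding k by auto
  have e: "e \<le> 2"
  proof (rule ccontr)
    assume "\<not> e \<le> 2"
    then have "even N" using N by simp
    then have "odd M" using assms(5) by auto
    have ord: "Polynomial.order 0 (mod2 ?P) = 2 ^ e - 1"
      unfolding P using order_fib2 [OF c] by (simp only: N)
    have dvd: "2 ^ (2 ^ e - 1) dvd poly ?P 0" "2 ^ (2 ^ e - 1) dvd poly ?P 4"
      using quadratic_split_order [OF split ne] unfolding ord by blast+
    \<comment> \<open>At 0 the even index \<open>N\<close> contributes 0 and the odd index
      \<open>M\<close> contributes 1, so the value is \<open>\<beta>\<close>.\<close>
    then have "2 ^ (2 ^ e - 1) dvd \<beta>"
      using \<open>even N\<close> \<open>odd M\<close> by (simp add: poly_chebsq_zero)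
    \<comment> \<open>At 4 the term with \<open>\<beta>\<close> can now be dropped. What remains has
      2-adic valuation only \<open>2 * e\<close>.\<close>
    then have "2 ^ (2 ^ e - 1) dvd poly ?P 4 - \<beta> * (int M)\<^sup>2" using dvd(2) by (intro dvd_diff) auto
    then have "2 ^ (2 ^ e - 1) dvd \<alpha> * (int N)\<^sup>2" by (simp add: poly_chebsq_four)
    moreover have "\<alpha> * (int N)\<^sup>2 = (\<alpha> * (int c)\<^sup>2) * 2 ^ (2 * e)"
      by (simp add: N power_mult_distrib power_even_eq)
    ultimately have "(2::int) ^ (2 ^ e - 1) dvd (\<alpha> * (int c)\<^sup>2) * 2 ^ (2 * e)" by (simp only:)
    moreover have "coprime (2 ^ (2 ^ e - 1)) (\<alpha> * (int c)\<^sup>2)"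
      using \<open>odd \<alpha>\<close> c by (intro coprime_power_left_iff [THEN iffD2]) auto
    ultimately have "(2::int) ^ (2 ^ e - 1) dvd 2 ^ (2 * e)"
      by (simp only: coprime_dvd_mult_right_iff)
    then have "2 ^ e - 1 \<le> 2 * e" by (simp add: dvd_power_iff)
    moreover have "2 * i + 1 < 2 ^ i" if "3 \<le> i" for i :: nat
      using that by (induction rule: dec_induct) auto
    then have "2 * e + 1 < 2 ^ e" using \<open>\<not> e \<le> 2\<close> by simp
    ultimately show False by linarith
  qed
  \<comment> \<open>Among the products of 1, 2, 4 with 1, 3, 5 only 20 exceeds 12.\<close>
  have "N \<noteq> 20"
    using not_quadratic_split_20 [OF assms(2,3), of M] split assms(5) by auto
  moreover have "e = 0 \<or> e = 1 \<or> e = 2" using e by auto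
  ultimately show ?thesis using N c5 by auto
qed

text \<open>By coprimality some coefficient is odd. If only one is, the preceding bound applies to
  its index, \<open>Suc D\<close> or \<open>D\<close>; if both are, the reduction is
  \<open>fibsum2 D\<close>.\<close>

lemma chebsq_split_bound:
  assumes split: "quadratic_split (Polynomial.smult t (chebsq (Suc D)) - Polynomial.smult s (chebsq D))"
    and "coprime s t" "D > 0"
  shows "D \<le> 12"
proof -
  have P: "Polynomial.smult t (chebsq (Suc D)) - Polynomial.smult s (chebsq D) =
      Polynomial.smult t (chebsq (Suc D)) + Polynomial.smult (- s) (chebsq D)"
    "Polynomial.smult t (chebsq (Suc D)) - Polynomial.smult s (chebsq D)
      = Polynomial.smult (- s) (chebsq D) + Polynomial.smult t (chebsq (Suc D))" by simp_all
  have "odd s \<or> odd t" using \<open>coprime s t\<close> by (meson coprime_common_divisor odd_one)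
  then consider "odd t" "even s" | "even t" "odd s" | "odd s" "odd t" by blast
  then show ?thesis
  proof cases
    case 1
    then show ?thesis using chebsq_split_even_bound [OF split [unfolded P(1)]] by simp
  next
    case 2
    then show ?thesis using chebsq_split_even_bound [OF split [unfolded P(2)]] \<open>D > 0\<close> by simp
  next
    case 3
    then have "mod2 (Polynomial.smult t (chebsq (Suc D)) - Polynomial.smult s (chebsq D)) = fibsum2 D"
      by (simp add: mod2_chebsq fibsum2_def bit_poly_diff)
    moreover have "fibsum2 D \<noteq> 0" using poly_fibsum2_zero [of D] by auto
    ultimately show ?thesis using fibsum2_dvd_quadratic_split [OF split, of D] by simp
  qed
qed

section \<open>Roots of degree at most 2\<close>

text \<open>Gauss's lemma: the primitive \<open>f\<close> does not affect the content, so
  \<open>l\<close> divides the content of \<open>q\<close>.\<close>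

lemma primitive_dvd_cancel:
  fixes f P q :: "int poly"
  assumes "content f = 1" "l \<noteq> 0" "Polynomial.smult l P = f * q"
  shows "f dvd P"
proof -
  have "content (Polynomial.smult l P) = content q"
    unfolding assms(3) content_mult assms(1) by simp
  then have "\<bar>l\<bar> * content P = content q" by simp
  then have "\<bar>l\<bar> dvd content q" by (metis dvd_triv_left)
  then have "l dvd content q" by simp
  then have "[:l:] dvd q" by (simp add: const_poly_dvd_iff_dvd_content)
  then obtain q' where "q = [:l:] * q'" unfolding dvd_def by blast
  then have "Polynomial.smult l P = Polynomial.smult l (f * q')" using assms(3) by simp
  then have "P = f * q'" using assms(2) by (metis smult_cancel)
  then show ?thesis by simp
qed

text \<open>Induction on the degree: an integer annihilator of minimal degree of some root, made
  primitive, divides \<open>P\<close>, and the quotient inherits the assumption on the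
  roots.\<close>

lemma quadratic_split_of_roots:
  fixes P :: "int poly"
  assumes "P \<noteq> 0"
    and "\<And>z :: complex. poly (of_int_poly P) z = 0 \<Longrightarrow>
      \<exists>f. f \<noteq> 0 \<and> degree f \<le> 2 \<and> poly (of_int_poly f) z = 0 \<and>
        (degree f = 2 \<longrightarrow> (\<exists>r. coeff f 0 * coeff f 2 = r\<^sup>2))"
  shows "quadratic_split P"
  using assms
proof (induction "degree P" arbitrary: P rule: less_induct)
  case less
  show ?case
  proof (cases "degree P = 0")
    case True
    then obtain c where "P = [:c:]" by (auto elim: degree_eq_zeroE)
    then show ?thesis using quadratic_split.const less.prems(1) by auto
  next
    case False
    have "\<not> constant (poly (of_int_poly P :: complex poly))"
      using False by (simp add: constant_degree)
    then obtain z :: complex where z: "poly (of_int_poly P) z = 0"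
      using fundamental_theorem_of_algebra by blast
    obtain f1 where f1: "f1 \<noteq> 0" "degree f1 \<le> 2" "poly (of_int_poly f1) z = 0"
      "degree f1 = 2 \<longrightarrow> (\<exists>r. coeff f1 0 * coeff f1 2 = r\<^sup>2)"
      using less.prems(2) [OF z] by blast
    define ann where "ann h \<longleftrightarrow> h \<noteq> 0 \<and> poly (of_int_poly h) z = 0" for h
    obtain f2 where f2: "ann f2" "\<And>h. ann h \<Longrightarrow> degree f2 \<le> degree h"
      using ex_has_least_nat [of ann f1 degree] f1 by (auto simp: ann_def)
    \<comment> \<open>If the minimal degree is 2, the given \<open>f1\<close> also attains it and
      satisfies the square condition.\<close>
    define f0 where "f0 = (if degree f2 = 2 then f1 else f2)"
    have "degree f2 \<le> degree f1" using f2(2) f1 by (simp add: ann_def)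
    then have f0: "ann f0" "degree f0 \<le> 2" "degree f0 = degree f2"
      "degree f0 = 2 \<Longrightarrow> \<exists>r. coeff f0 0 * coeff f0 2 = r\<^sup>2"
      using f1 f2(1) by (auto simp: f0_def ann_def)
    define f where "f = primitive_part f0"
    define c where "c = content f0"
    have f0c: "f0 = Polynomial.smult c f" by (simp add: f_def c_def)
    have "f0 \<noteq> 0" using f0(1) by (simp add: ann_def)
    then have c: "c \<noteq> 0" "f \<noteq> 0" and cont: "content f = 1" by (simp_all add: f_def c_def)
    have deg: "degree f = degree f0" using c by (simp add: f0c)
    have fz: "poly (of_int_poly f) z = 0"
      using f0(1) c unfolding ann_def f0c by (simp add: of_int_hom.map_poly_hom_smult)
    have sq: "\<exists>r. coeff f 0 * coeff f 2 = r\<^sup>2" if "degree f = 2"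
    proof -
      have "degree f0 = 2" using that deg by simp
      then obtain r where "coeff f0 0 * coeff f0 2 = r\<^sup>2" using f0(4) by blast
      then have r: "c\<^sup>2 * (coeff f 0 * coeff f 2) = r\<^sup>2"
        by (simp add: f0c power2_eq_square ac_simps)
      then have "c\<^sup>2 dvd r\<^sup>2" by (metis dvd_triv_left)
      then have "c dvd r" by (simp add: pow_divides_pow_iff)
      then obtain k where "r = c * k" unfolding dvd_def by blast
      then have "coeff f 0 * coeff f 2 = k\<^sup>2" using r c by (simp add: power_mult_distrib)
      then show ?thesis by blast
    qed
    obtain q r where qr: "pseudo_divmod P f = (q, r)" by (metis surj_pair)
    define l where "l = lead_coeff f ^ (Suc (degree P) - degree f)"
    have l: "Polynomial.smult l P = f * q + r" and r: "r = 0 \<or> degree r < degree f"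
      using pseudo_divmod [OF c(2) qr] by (simp_all add: l_def)
    have "poly (of_int_poly (Polynomial.smult l P)) z = poly (of_int_poly (f * q + r)) z" by (simp add: l)
    then have "poly (of_int_poly r) z = 0"
      using z fz by (simp add: of_int_hom.map_poly_hom_smult of_int_poly_hom.hom_add of_int_poly_hom.hom_mult)
    \<comment> \<open>A nonzero pseudo-remainder would annihilate \<open>z\<close> in less than the
      minimal degree.\<close>
    then have "r = 0" using r f2(2) deg f0(3) unfolding ann_def by (metis not_less)
    then have "Polynomial.smult l P = f * q" using l by simp
    moreover have "l \<noteq> 0" using c by (simp add: l_def)
    ultimately have "f dvd P" using cont by (intro primitive_dvd_cancel)
    then obtain Q where Q: "P = f * Q" unfolding dvd_def by blast
    have "degree f > 0"
    proof (rule ccontr)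
      assume "\<not> ?thesis"
      then obtain a where "f = [:a:]" by (auto elim: degree_eq_zeroE)
      then show False using fz c by simp
    qed
    moreover have "Q \<noteq> 0" using Q less.prems(1) by auto
    ultimately have "degree Q < degree P" using Q c by (simp add: degree_mult_eq)
    moreover have "\<exists>f. f \<noteq> 0 \<and> degree f \<le> 2 \<and> poly (of_int_poly f) z = 0 \<and>
        (degree f = 2 \<longrightarrow> (\<exists>r. coeff f 0 * coeff f 2 = r\<^sup>2))"
      if "poly (of_int_poly Q) z = 0" for z :: complex
      using less.prems(2) [of z] that by (simp add: Q of_int_poly_hom.hom_mult)
    ultimately have "quadratic_split Q" using less.hyps \<open>Q \<noteq> 0\<close> by blast
    then show ?thesis unfolding Q
      using c(2) f0(2) deg sq by (intro quadratic_split.mult) auto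
  qed
qed

text \<open>Indices are shifted: \<open>cheb n x k\<close> is the \<open>W\<^sub>k\<^sub>-\<^sub>1 (x)\<close> above, for \<open>n = s t\<close>.\<close>
fun cheb :: "complex \<Rightarrow> complex \<Rightarrow> nat \<Rightarrow> complex" where
  "cheb n x 0 = 0"
| "cheb n x (Suc 0) = 1"
| "cheb n x (Suc (Suc k)) = x * cheb n x (Suc k) - n * cheb n x k"

lemma cheb_minus: "cheb n (- x) k = - ((-1) ^ k * cheb n x k)"
  by (induction n x k rule: cheb.induct) (auto simp: algebra_simps)

text \<open>A Cassini identity. It removes the mixed product in \<open>cheb_square\<close>, so that
  the squares alone satisfy a recurrence.\<close>

lemma cheb_turan: "cheb n x (Suc (Suc k)) * cheb n x k = (cheb n x (Suc k))\<^sup>2 - n ^ k"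
proof (induction k)
  case (Suc k)
  let ?c = "cheb n x"
  have "?c (Suc (Suc (Suc k))) * ?c (Suc k)
      = (x * ?c (Suc k)) * ?c (Suc (Suc k)) - n * (?c (Suc k))\<^sup>2"
    by (simp only: cheb.simps(3) [of n x "Suc k"]) (simp only: power2_eq_square algebra_simps)
  also have "x * ?c (Suc k) = ?c (Suc (Suc k)) + n * ?c k" by simp
  also have "(?c (Suc (Suc k)) + n * ?c k) * ?c (Suc (Suc k)) - n * (?c (Suc k))\<^sup>2
      = (?c (Suc (Suc k)))\<^sup>2 + n * (?c (Suc (Suc k)) * ?c k - (?c (Suc k))\<^sup>2)"
    by (simp only: power2_eq_square algebra_simps)
  finally show ?case by (simp only: Suc) simp
qed simp

text \<open>Squaring \<open>x * c1 = c2 + n * c0\<close> and applying \<open>cheb_turan\<close>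
  gives the recurrence of \<open>chebsq\<close>. The factor \<open>n\<close> on the left avoids the
  exponent \<open>k - 1\<close>.\<close>

lemma cheb_square:
  assumes "x\<^sup>2 = n * y"
  shows "n * (cheb n x k)\<^sup>2 = n ^ k * poly (of_int_poly (chebsq k)) y"
proof (induction k rule: chebsq.induct)
  case (3 k)
  let ?c = "cheb n x" and ?q = "\<lambda>k. poly (of_int_poly (chebsq k)) y"
  have q: "?q (Suc (Suc k)) = (y - 2) * ?q (Suc k) - ?q k + 2"
    by (simp add: hom_distribs map_poly_pCons algebra_simps)
  have "(?c (Suc (Suc k)) + n * ?c k)\<^sup>2 = (x * ?c (Suc k))\<^sup>2" by simp
  moreover have "n * c2\<^sup>2 = (x\<^sup>2 - 2 * n) * (n * c1\<^sup>2) - n\<^sup>2 * (n * c0\<^sup>2) + 2 * n\<^sup>2 * p"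
    if "(c2 + n * c0)\<^sup>2 = (x * c1)\<^sup>2" "c2 * c0 = c1\<^sup>2 - p" for c0 c1 c2 p :: complex
  proof -
    have "n * c2\<^sup>2 = n * (c2 + n * c0)\<^sup>2 - 2 * n\<^sup>2 * (c2 * c0) - n\<^sup>2 * (n * c0\<^sup>2)"
      by (simp add: power2_eq_square algebra_simps)
    also have "\<dots> = n * (x * c1)\<^sup>2 - 2 * n\<^sup>2 * (c1\<^sup>2 - p) - n\<^sup>2 * (n * c0\<^sup>2)"
      by (simp only: that)
    finally show ?thesis by (simp add: power2_eq_square algebra_simps)
  qed
  ultimately have "n * (?c (Suc (Suc k)))\<^sup>2 =
      (x\<^sup>2 - 2 * n) * (n * (?c (Suc k))\<^sup>2) - n\<^sup>2 * (n * (?c k)\<^sup>2) + 2 * n\<^sup>2 * n ^ k"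
    using cheb_turan by blast
  also have "\<dots> = n ^ Suc (Suc k) * ?q (Suc (Suc k))"
    by (simp only: 3 q assms) (simp add: algebra_simps power2_eq_square)
  finally show ?case .
qed simp_all

text \<open>Every root \<open>y\<close> of the integer polynomial \<open>P\<close> is
  \<open>w\<^sup>2 / n\<close> for a root \<open>w\<close> as in \<open>quad\<close>, and the
  quadratic equation of \<open>w\<close> yields one for \<open>y\<close> with the square
  condition.\<close>

theorem cheb_root_bound:
  fixes s t :: int and D :: nat
  defines "n \<equiv> s * t"
  assumes "s > 0" "t > 0" "D > 0"
    and quad: "\<And>z :: complex. cheb n z (Suc D) + s * cheb n z D = 0 \<Longrightarrow>
      \<exists>(a :: int) (b :: int) (c :: int). \<not> (a = 0 \<and> b = 0 \<and> c = 0) \<and> a * z\<^sup>2 + b * z + c = 0"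
  shows "D \<le> 12"
proof -
  \<comment> \<open>Dividing by the gcd keeps the roots and makes the coefficients coprime, so that
    they are not both even.\<close>
  define g where "g = gcd s t"
  have "g > 0" using \<open>s > 0\<close> by (simp add: g_def)
  then obtain s' t' where st': "s = s' * g" "t = t' * g" "coprime s' t'"
    using gcd_coprime_exists [of s t] unfolding g_def by (metis less_irrefl)
  then have st: "s = g * s'" "t = g * t'" "coprime s' t'" by (simp_all only: mult.commute)
  define P where "P = Polynomial.smult t' (chebsq (Suc D)) - Polynomial.smult s' (chebsq D)"
  have nz: "s' \<noteq> 0" "t' \<noteq> 0" "n > 0" using st assms(2,3) by (auto simp: n_def)
  have "poly P 0 \<noteq> 0" using nz by (simp add: P_def poly_chebsq_zero)
  then have "P \<noteq> 0" by auto
  moreover have "\<exists>f. f \<noteq> 0 \<and> degree f \<le> 2 \<and> poly (of_int_poly f) y = 0 \<and>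
        (degree f = 2 \<longrightarrow> (\<exists>r. coeff f 0 * coeff f 2 = r\<^sup>2))"
    if y: "poly (of_int_poly P) y = 0" for y :: complex
  proof -
    let ?q = "\<lambda>k. poly (of_int_poly (chebsq k)) y"
    define x where "x = csqrt (n * y)"
    have x: "x\<^sup>2 = n * y" by (simp add: x_def)
    have "of_int t' * ?q (Suc D) = of_int s' * ?q D"
      using y by (simp add: P_def of_int_poly_hom.hom_minus of_int_hom.map_poly_hom_smult)
    then have eq: "t * ?q (Suc D) = s * ?q D" by (simp add: st)
    have "n * ((cheb n x (Suc D))\<^sup>2 - (s * cheb n x D)\<^sup>2) = n * (cheb n x (Suc D))\<^sup>2 - s\<^sup>2 * (n * (cheb n x D)\<^sup>2)"
      by (simp add: algebra_simps power_mult_distrib)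
    also have "\<dots> = n ^ D * s * (t * ?q (Suc D) - s * ?q D)"
      unfolding cheb_square [OF x] by (simp add: n_def algebra_simps power2_eq_square)
    finally have "(cheb n x (Suc D))\<^sup>2 = (s * cheb n x D)\<^sup>2" using eq nz(3) by simp
    then have "cheb n x (Suc D) = - (s * cheb n x D) \<or> cheb n x (Suc D) = s * cheb n x D"
      by (auto simp: power2_eq_iff)
    then have "\<exists>w. cheb n w (Suc D) + s * cheb n w D = 0 \<and> w\<^sup>2 = n * y"
    proof (elim disjE)
      assume a: "cheb n x (Suc D) = - (s * cheb n x D)"
      have "cheb n x (Suc D) + s * cheb n x D = 0" unfolding a by (rule left_minus)
      then show ?thesis using x by blast
    next
      \<comment> \<open>With the wrong sign, parity makes \<open>- x\<close> the root.\<close>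
      assume a: "cheb n x (Suc D) = s * cheb n x D"
      have "cheb n (- x) (Suc D) + s * cheb n (- x) D = 0"
        unfolding cheb_minus a by simp
      moreover have "(- x)\<^sup>2 = n * y" using x by simp
      ultimately show ?thesis by blast
    qed
    then obtain w where w: "cheb n w (Suc D) + s * cheb n w D = 0" "w\<^sup>2 = n * y" by blast
    obtain a b c :: int where abc: "\<not> (a = 0 \<and> b = 0 \<and> c = 0)" "a * w\<^sup>2 + b * w + c = 0"
      using quad [OF w(1)] by blast
    \<comment> \<open>This is the product of the quadratic at \<open>w\<close> and at
      \<open>- w\<close>, an even polynomial in \<open>w\<close>, rewritten by
      \<open>w\<^sup>2 = n * y\<close>; its outer coefficients are squares.\<close>
    define f where "f = [:c\<^sup>2, 2 * a * c * n - b\<^sup>2 * n, (a * n)\<^sup>2:]"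
    have "f \<noteq> 0" using abc(1) nz(3) by (auto simp: f_def)
    moreover have "degree f \<le> 2" by (simp add: f_def)
    moreover have "poly (of_int_poly f) y = 0"
    proof -
      have "poly (of_int_poly f) y = (a * (n * y) + c)\<^sup>2 - b\<^sup>2 * (n * y)"
        by (simp add: f_def hom_distribs map_poly_pCons power2_eq_square algebra_simps)
      also have "\<dots> = (a * w\<^sup>2 + c)\<^sup>2 - b\<^sup>2 * w\<^sup>2" by (simp only: w(2))
      also have "\<dots> = (a * w\<^sup>2 + b * w + c) * (a * w\<^sup>2 - b * w + c)"
        by (simp add: power2_eq_square algebra_simps)
      finally show ?thesis using abc(2) by simp
    qed
    moreover have "coeff f 0 * coeff f 2 = (c * (a * n))\<^sup>2"
      by (simp add: f_def numeral_2_eq_2 power_mult_distrib)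
    ultimately show ?thesis by blast
  qed
  ultimately have "quadratic_split P" by (rule quadratic_split_of_roots)
  then show ?thesis using chebsq_split_bound st(3) \<open>D > 0\<close> unfolding P_def by blast
qed

section \<open>Multiplicities of eigenvalues\<close>

text \<open>Evaluated at the shifted adjacency matrix of collinearity, these are the sums of the
  distance matrices up to \<open>k\<close>. Every shifted eigenvalue other than the valency is a
  root for \<open>k = D\<close>.\<close>

fun chebG :: "complex \<Rightarrow> complex \<Rightarrow> complex \<Rightarrow> nat \<Rightarrow> complex" where
  "chebG n s x 0 = 1"
| "chebG n s x (Suc 0) = x + s"
| "chebG n s x (Suc (Suc k)) = x * chebG n s x (Suc k) - n * chebG n s x k"

lemma chebG_eq_cheb: "chebG n s x k = cheb n x (Suc k) + s * cheb n x k"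
proof (induction n s x k rule: chebG.induct)
  case (3 n s x k)
  show ?case unfolding chebG.simps 3 by (simp add: algebra_simps)
qed simp_all

text \<open>The kernel that divides \<open>chebG n s x D - chebG n s z D\<close> by \<open>x - z\<close>.\<close>
definition chebG_kernel :: "complex \<Rightarrow> complex \<Rightarrow> complex \<Rightarrow> complex \<Rightarrow> nat \<Rightarrow> complex" where
  "chebG_kernel n s x z D = (\<Sum>i<D. cheb n z (D - i) * chebG n s x i)"

lemma chebG_kernel_Suc_Suc:
  "chebG_kernel n s x z (Suc (Suc D))
    = z * chebG_kernel n s x z (Suc D) - n * chebG_kernel n s x z D + chebG n s x (Suc D)"
proof -
  have "(\<Sum>i<Suc D. cheb n z (Suc (Suc D) - i) * chebG n s x i)
      = (\<Sum>i<Suc D. z * (cheb n z (Suc D - i) * chebG n s x i) - n * (cheb n z (D - i) * chebG n s x i))"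
  proof (rule sum.cong)
    fix i assume "i \<in> {..<Suc D}"
    then have "Suc (Suc D) - i = Suc (Suc (D - i))" "Suc D - i = Suc (D - i)" by auto
    then show "cheb n z (Suc (Suc D) - i) * chebG n s x i
        = z * (cheb n z (Suc D - i) * chebG n s x i) - n * (cheb n z (D - i) * chebG n s x i)"
      by (simp add: algebra_simps)
  qed simp
  \<comment> \<open>At \<open>i = D\<close> the second term is \<open>cheb n z 0 = 0\<close>, so the
    range fits the kernel for \<open>D\<close>.\<close>
  also have "\<dots> = z * chebG_kernel n s x z (Suc D) - n * chebG_kernel n s x z D"
    unfolding sum_subtractf sum_distrib_left [symmetric] chebG_kernel_def by simp
  finally show ?thesis unfolding chebG_kernel_def [of n s x z "Suc (Suc D)"] by simp
qed

lemma chebG_kernel: "(x - z) * chebG_kernel n s x z D = chebG n s x D - chebG n s z D"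
proof (induction n s x D rule: chebG.induct)
  case (3 n s x k)
  have "(x - z) * chebG_kernel n s x z (Suc (Suc k))
      = z * ((x - z) * chebG_kernel n s x z (Suc k)) - n * ((x - z) * chebG_kernel n s x z k)
        + (x - z) * chebG n s x (Suc k)"
    unfolding chebG_kernel_Suc_Suc by (simp only: algebra_simps)
  also have "\<dots> = chebG n s x (Suc (Suc k)) - chebG n s z (Suc (Suc k))"
    unfolding 3 by (simp add: algebra_simps)
  finally show ?case .
qed (simp_all add: chebG_kernel_def)

text \<open>On the diagonal the kernel is the derivative of \<open>chebG n s x D\<close> in \<open>x\<close>.\<close>
lemma chebG_kernel_diag:
  "(x\<^sup>2 - 4 * n) * chebG_kernel n s x x D =
    of_nat D * x * cheb n x (Suc D) - 2 * of_nat (Suc D) * n * cheb n x D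
    + s * ((of_nat D - 1) * x * cheb n x D - 2 * of_nat D * n * (if D = 0 then 0 else cheb n x (D - 1)))"
proof (induction n s x D rule: chebG.induct)
  case (1 n s x)
  then show ?case by (simp add: chebG_kernel_def)
next
  case (2 n s x)
  then show ?case by (simp add: chebG_kernel_def algebra_simps power2_eq_square)
next
  case (3 n s x k)
  have c: "n * (if k = 0 then 0 else cheb n x (k - 1)) = (if k = 0 then 0 else x * cheb n x k - cheb n x (Suc k))"
    by (cases k) auto
  show ?case
  proof (cases k)
    case 0
    then show ?thesis
      by (simp add: chebG_kernel_def lessThan_Suc algebra_simps power2_eq_square power3_eq_cube)
  next
    case (Suc l)
    have "(x\<^sup>2 - 4 * n) * chebG_kernel n s x x (Suc (Suc k))
      = x * ((x\<^sup>2 - 4 * n) * chebG_kernel n s x x (Suc k)) - n * ((x\<^sup>2 - 4 * n) * chebG_kernel n s x x k)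
        + (x\<^sup>2 - 4 * n) * chebG n s x (Suc k)"
      unfolding chebG_kernel_Suc_Suc by (simp only: algebra_simps)
    also have "\<dots> = of_nat (Suc (Suc k)) * x * cheb n x (Suc (Suc (Suc k)))
        - 2 * of_nat (Suc (Suc (Suc k))) * n * cheb n x (Suc (Suc k))
        + s * ((of_nat (Suc (Suc k)) - 1) * x * cheb n x (Suc (Suc k))
        - 2 * of_nat (Suc (Suc k)) * n * cheb n x (Suc k))"
      unfolding 3 by (simp add: chebG_eq_cheb Suc algebra_simps power2_eq_square)
    finally show ?thesis by simp
  qed
qed

lemma sum_cheb:
  "(x - 1 - n) * (\<Sum>i<D. cheb n x (D - i)) = cheb n x (Suc D) - n * cheb n x D - 1"
proof -
  have "(\<Sum>i<D. cheb n x (D - i)) = (\<Sum>i<D. cheb n x (Suc i))"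
    by (rule sum.reindex_bij_witness [where i = "\<lambda>i. D - Suc i" and j = "\<lambda>i. D - Suc i"])
      (auto simp: Suc_diff_Suc simp del: cheb.simps)
  moreover have "(x - 1 - n) * (\<Sum>i<D. cheb n x (Suc i)) = cheb n x (Suc D) - n * cheb n x D - 1"
    by (induction D) (auto simp: algebra_simps)
  ultimately show ?thesis by simp
qed

text \<open>\<open>1 + n\<close> is the shifted valency \<open>s * (t + 1) - (s - 1)\<close>. It is
  no root, because there the sequence starts positive and its increments are multiplied by
  \<open>n\<close> in each step.\<close>

lemma chebG_one_plus:
  fixes n s :: real
  assumes "n > 0" "s > 0"
  shows "\<exists>r. chebG n s (of_real (1 + n)) k = of_real r \<and> r > 0"
proof -
  have "\<exists>r r'. chebG n s (of_real (1 + n)) k = of_real r \<and> chebG n s (of_real (1 + n)) (Suc k) = of_real r'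
      \<and> 0 < r \<and> r \<le> r'"
  proof (induction k)
    case 0
    show ?case by (rule exI [of _ 1], rule exI [of _ "1 + n + s"]) (use assms in auto)
  next
    case (Suc k)
    then obtain r r' where r: "chebG n s (of_real (1 + n)) k = of_real r"
      "chebG n s (of_real (1 + n)) (Suc k) = of_real r'" "0 < r" "r \<le> r'" by blast
    have "chebG n s (of_real (1 + n)) (Suc (Suc k)) = of_real ((1 + n) * r' - n * r)"
      unfolding chebG.simps r by simp
    moreover have "r' \<le> (1 + n) * r' - n * r"
      using r(4) assms(1) by (simp add: algebra_simps mult_left_mono)
    ultimately show ?case using r by (metis order_less_le_trans)
  qed
  then show ?thesis by blast
qed

text \<open>\<open>es\<close> is the spectrum with multiplicities. Summed over \<open>es\<close>,
  the kernel at \<open>z\<close> keeps only the terms at \<open>z\<close> and at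
  \<open>1 + n\<close>; expanded in the \<open>chebG\<close>, whose traces are all \<open>v\<close>,
  the same sum is given by \<open>sum_cheb\<close>. Comparison determines \<open>m\<close>.\<close>

theorem multiplicity_formula:
  fixes es :: "complex list" and s t :: nat and z :: complex
  defines "n \<equiv> s * t"
  assumes st: "s > 0" "t > 0"
    and tr: "\<And>i. i \<le> D \<Longrightarrow> (\<Sum>e\<leftarrow>es. chebG n s e i) = v"
    and ann: "\<And>e. e \<in> set es \<Longrightarrow> (e - (1 + n)) * chebG n s e D = 0"
    and z: "chebG n s z D = 0" and "D > 0"
  defines "m \<equiv> count_list es z"
  shows "of_nat m * (1 + n - z) * (2 * t * (D + 1) + 2 * D * s + (2 * D + 1) * z)
      = v * (t + 1) * (4 * n - z\<^sup>2)"
proof -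
  let ?K = "of_nat (1 + n) :: complex"
  let ?G = "chebG n s"
  let ?U = "cheb n z"
  have n: "n > 0" using st by (simp add: n_def)
  have GK: "?G ?K D \<noteq> 0"
    using chebG_one_plus [of "real n" "real s" D] n st by auto
  then have zK: "z \<noteq> ?K" using z by auto
  define \<kappa> where "\<kappa> = count_list es ?K"
  have sum_split: "(\<Sum>e\<leftarrow>es. f e) = of_nat m * f z + of_nat \<kappa> * f ?K"
    if "\<And>e. e \<in> set es \<Longrightarrow> e \<noteq> z \<Longrightarrow> e \<noteq> ?K \<Longrightarrow> f e = 0" for f :: "complex \<Rightarrow> complex"
    using that unfolding m_def \<kappa>_def
    by (induction es) (use zK in \<open>auto simp: algebra_simps\<close>)
  \<comment> \<open>The trace at \<open>D\<close> fixes the contribution of \<open>1 + n\<close>, as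
    all other terms vanish.\<close>
  have "v = (\<Sum>e\<leftarrow>es. ?G e D)" using tr by simp
  also have "\<dots> = of_nat m * ?G z D + of_nat \<kappa> * ?G ?K D"
    by (rule sum_split) (use ann in force)
  finally have v\<kappa>: "of_nat \<kappa> * ?G ?K D = v" using z by simp
  let ?k = "\<lambda>x. chebG_kernel n s x z D"
  have ker: "(x - z) * ?k x = ?G x D" for x using chebG_kernel [of x z n s D] z by simp
  have "(\<Sum>e\<leftarrow>es. ?k e) = (\<Sum>i<D. ?U (D - i) * (\<Sum>e\<leftarrow>es. ?G e i))"
    unfolding chebG_kernel_def by (induction es) (auto simp: sum.distrib distrib_left)
  also have "\<dots> = v * (\<Sum>i<D. ?U (D - i))" by (simp add: tr sum_distrib_left mult.commute)
  finally have "v * (\<Sum>i<D. ?U (D - i)) = (\<Sum>e\<leftarrow>es. ?k e)" by simp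
  also have "\<dots> = of_nat m * ?k z + of_nat \<kappa> * ?k ?K"
  proof (rule sum_split)
    fix e assume "e \<in> set es" "e \<noteq> z" "e \<noteq> ?K"
    then show "?k e = 0" using ann [of e] ker [of e] by auto
  qed
  finally have e: "v * (\<Sum>i<D. ?U (D - i)) = of_nat m * ?k z + of_nat \<kappa> * ?k ?K" .
  have "v * ((?K - z) * (\<Sum>i<D. ?U (D - i))) = (?K - z) * (v * (\<Sum>i<D. ?U (D - i)))"
    by (simp only: ac_simps)
  also have "\<dots> = of_nat m * (?K - z) * ?k z + of_nat \<kappa> * ((?K - z) * ?k ?K)"
    unfolding e by (simp only: distrib_left ac_simps)
  also have "\<dots> = of_nat m * (?K - z) * ?k z + v" unfolding ker v\<kappa> ..
  finally have e': "v * ((?K - z) * (\<Sum>i<D. ?U (D - i))) = of_nat m * (?K - z) * ?k z + v" .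
  \<comment> \<open>Since \<open>z\<close> is a root, both neighbours of \<open>?U D\<close> are
    expressed by \<open>?U D\<close>, which cancels at the end.\<close>
  have US: "?U (Suc D) = - s * ?U D" using z unfolding chebG_eq_cheb by (simp add: add_eq_0_iff)
  have "(?K - z) * (\<Sum>i<D. ?U (D - i)) = - ((z - 1 - n) * (\<Sum>i<D. ?U (D - i)))"
    by (simp add: algebra_simps)
  also have "\<dots> = (s + n) * ?U D + 1" unfolding sum_cheb US by (simp add: algebra_simps)
  finally have "v * ((s + n) * ?U D + 1) = of_nat m * (?K - z) * ?k z + v" using e' by (simp only:)
  then have "v * ((s + n) * ?U D) + v = of_nat m * (?K - z) * ?k z + v"
    by (simp only: distrib_left mult_1_right)
  then have main: "v * ((s + n) * ?U D) = of_nat m * (?K - z) * ?k z" by (simp only: add_right_cancel)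
  obtain d where d: "D = Suc d" using \<open>D > 0\<close> gr0_implies_Suc by blast
  have nU: "n * ?U (D - 1) = (z + s) * ?U D" using US by (simp add: d algebra_simps)
  have "(z\<^sup>2 - 4 * n) * ?k z = of_nat D * z * ?U (Suc D) - 2 * of_nat (Suc D) * n * ?U D
    + s * ((of_nat D - 1) * z * ?U D - 2 * of_nat D * (n * ?U (D - 1)))"
    using chebG_kernel_diag [of z n s D] \<open>D > 0\<close> by (simp add: algebra_simps)
  also have "\<dots> = - (s * (2 * t * (D + 1) + 2 * D * s + (2 * D + 1) * z)) * ?U D"
    unfolding US nU by (simp add: n_def algebra_simps)
  finally have diag: "(4 * n - z\<^sup>2) * ?k z = s * (2 * t * (D + 1) + 2 * D * s + (2 * D + 1) * z) * ?U D"
    by (simp add: algebra_simps)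
  \<comment> \<open>Two consecutive zeros would propagate down to \<open>?U 1 = 1\<close>.\<close>
  have UD: "?U D \<noteq> 0"
  proof
    assume U: "?U D = 0"
    have "?U i = 0 \<and> ?U (Suc i) = 0" if "i \<le> D" for i
      using that
    proof (induction rule: inc_induct)
      case base
      then show ?case using U US by simp
    next
      case (step i)
      have "n * ?U i = z * ?U (Suc i) - ?U (Suc (Suc i))" by simp
      also have "\<dots> = 0"
        using conjunct1 [OF step.IH] conjunct2 [OF step.IH] by (simp del: cheb.simps)
      finally show ?case using n step.IH by simp
    qed
    from this [of 0] show False by simp
  qed
  have "s * (of_nat m * (1 + n - z) * (2 * t * (D + 1) + 2 * D * s + (2 * D + 1) * z)) * ?U D
    = of_nat m * (?K - z) * ((4 * n - z\<^sup>2) * ?k z)"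
    unfolding diag by (simp add: algebra_simps)
  also have "\<dots> = (4 * n - z\<^sup>2) * (v * ((s + n) * ?U D))" unfolding main by (simp only: ac_simps)
  also have "\<dots> = s * (v * (t + 1) * (4 * n - z\<^sup>2)) * ?U D"
    by (simp add: n_def algebra_simps)
  finally show ?thesis using UD st(1) by (auto simp: ac_simps)
qed

section \<open>Traces and triangular matrices\<close>

lemma upper_triangular_mult:
  fixes A B :: "'a :: semiring_0 mat"
  assumes A: "A \<in> carrier_mat n n" "upper_triangular A" and B: "B \<in> carrier_mat n n" "upper_triangular B"
  shows "upper_triangular (A * B)"
    and "j < n \<Longrightarrow> (A * B) $$ (j, j) = A $$ (j, j) * B $$ (j, j)"
proof -
  have prod: "(A * B) $$ (i, j) = (\<Sum>k<n. A $$ (i, k) * B $$ (k, j))" if "i < n" "j < n" for i j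
    using that A B by (auto simp: scalar_prod_def atLeast0LessThan)
  show "upper_triangular (A * B)"
  proof
    fix i j assume "j < i" "i < dim_row (A * B)"
    then have ij: "i < n" "j < n" "j < i" using A by auto
    have "A $$ (i, k) * B $$ (k, j) = 0" if "k < n" for k
    proof (cases "k < i")
      case True
      then have "A $$ (i, k) = 0" using A ij by (intro upper_triangularD) auto
      then show ?thesis by simp
    next
      case False
      then have "B $$ (k, j) = 0" using B ij that by (intro upper_triangularD) auto
      then show ?thesis by simp
    qed
    then show "(A * B) $$ (i, j) = 0" using prod ij by simp
  qed
  show "(A * B) $$ (j, j) = A $$ (j, j) * B $$ (j, j)" if j: "j < n"
  proof -
    have "A $$ (j, k) * B $$ (k, j) = 0" if "k \<in> {..<n} - {j}" for k
    proof (cases "k < j")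
      case True
      then have "A $$ (j, k) = 0" using A j by (intro upper_triangularD) auto
      then show ?thesis by simp
    next
      case False
      then have "B $$ (k, j) = 0" using B j that by (intro upper_triangularD) auto
      then show ?thesis by simp
    qed
    then have "(\<Sum>k<n. A $$ (j, k) * B $$ (k, j)) = (\<Sum>k\<in>{j}. A $$ (j, k) * B $$ (k, j))"
      using j by (intro sum.mono_neutral_right) auto
    then show ?thesis using prod [OF j j] by simp
  qed
qed

lemma sum_diag_mult_commute:
  fixes A B :: "'a :: comm_semiring_0 mat"
  assumes "A \<in> carrier_mat n n" "B \<in> carrier_mat n n"
  shows "(\<Sum>j<n. (A * B) $$ (j, j)) = (\<Sum>j<n. (B * A) $$ (j, j))"
proof -
  have "(\<Sum>j<n. (A * B) $$ (j, j)) = (\<Sum>j<n. \<Sum>k<n. A $$ (j, k) * B $$ (k, j))"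
    using assms by (auto simp: scalar_prod_def atLeast0LessThan)
  also have "\<dots> = (\<Sum>k<n. \<Sum>j<n. B $$ (k, j) * A $$ (j, k))"
    by (subst sum.swap) (simp only: mult.commute)
  also have "\<dots> = (\<Sum>j<n. (B * A) $$ (j, j))"
    using assms by (auto simp: scalar_prod_def atLeast0LessThan)
  finally show ?thesis .
qed

fun mat_chebG :: "complex \<Rightarrow> complex \<Rightarrow> complex mat \<Rightarrow> nat \<Rightarrow> complex mat" where
  "mat_chebG n s A 0 = 1\<^sub>m (dim_row A)"
| "mat_chebG n s A (Suc 0) = A + s \<cdot>\<^sub>m 1\<^sub>m (dim_row A)"
| "mat_chebG n s A (Suc (Suc k)) = A * mat_chebG n s A (Suc k) - n \<cdot>\<^sub>m mat_chebG n s A k"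

lemma mat_chebG_carrier [simp]:
  "A \<in> carrier_mat m m \<Longrightarrow> mat_chebG n s A k \<in> carrier_mat m m"
  by (induction n s A k rule: mat_chebG.induct) auto

lemma mat_chebG_similar:
  assumes A: "A \<in> carrier_mat m m" and sim: "similar_mat_wit A B P Q"
  shows "mat_chebG n s A k = P * mat_chebG n s B k * Q"
proof -
  note S = similar_mat_witD2 [OF A sim]
  have dim: "dim_row A = m" "dim_row B = m" using S by auto
  have PQ: "P * (X * Y) * Q = (P * X * Q) * (P * Y * Q)" if "X \<in> carrier_mat m m" "Y \<in> carrier_mat m m" for X Y
  proof -
    have "Q * (P * Z) = Z" if "Z \<in> carrier_mat m m" for Z
      using assoc_mult_mat [of Q m m P m Z m] S that by simp
    then show ?thesis using S that by (simp add: assoc_mult_mat [of _ m m _ m _ m])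
  qed
  have smult: "P * (c \<cdot>\<^sub>m X) * Q = c \<cdot>\<^sub>m (P * X * Q)" if "X \<in> carrier_mat m m" for c X
    using S that by (simp add: mult_smult_distrib [of _ m m _ m] mult_smult_assoc_mat [of _ m m _ m])
  have minus: "P * (X - Y) * Q = P * X * Q - P * Y * Q" if "X \<in> carrier_mat m m" "Y \<in> carrier_mat m m" for X Y
    using S that by (simp add: mult_minus_distrib_mat [of _ m m _ m] minus_mult_distrib_mat [of _ m m _ _ m])
  have plus: "P * (X + Y) * Q = P * X * Q + P * Y * Q" if "X \<in> carrier_mat m m" "Y \<in> carrier_mat m m" for X Y
    using S that by (simp add: mult_add_distrib_mat [of _ m m _ m] add_mult_distrib_mat [of _ m m _ _ m])
  have one: "P * 1\<^sub>m m * Q = 1\<^sub>m m" using S by simp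
  show ?thesis
  proof (induction k rule: induct_nat_012)
    case 0
    show ?case using one by (simp add: dim)
  next
    case 1
    show ?case using S by (simp add: dim plus smult one)
  next
    case (ge2 k)
    have c: "mat_chebG n s B i \<in> carrier_mat m m" for i using S by simp
    show ?case
      unfolding mat_chebG.simps ge2 using S c
      by (simp add: minus smult PQ flip: S(3))
  qed
qed

lemma mat_chebG_upper_triangular:
  assumes B: "B \<in> carrier_mat m m" "upper_triangular B"
  shows "upper_triangular (mat_chebG n s B k) \<and>
    (\<forall>j<m. mat_chebG n s B k $$ (j, j) = chebG n s (B $$ (j, j)) k)"
proof (induction k rule: induct_nat_012)
  case 0
  show ?case using B by auto
next
  case 1
  show ?case using B by (auto simp: upper_triangular_def)
next
  case (ge2 k)
  have c: "mat_chebG n s B i \<in> carrier_mat m m" for i using B by simp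
  let ?C = "B * mat_chebG n s B (Suc k)"
  have C: "?C \<in> carrier_mat m m" "upper_triangular ?C"
    using B c upper_triangular_mult(1) [OF B c] ge2 by auto
  have "upper_triangular (mat_chebG n s B (Suc (Suc k)))"
  proof
    fix i j assume "j < i" "i < dim_row (mat_chebG n s B (Suc (Suc k)))"
    then have ij: "j < i" "i < m" "j < m" using c [of "Suc (Suc k)"] by auto
    then have "?C $$ (i, j) = 0" "mat_chebG n s B k $$ (i, j) = 0"
      using C ge2 c [of k] by (auto intro!: upper_triangularD)
    then show "mat_chebG n s B (Suc (Suc k)) $$ (i, j) = 0"
      using ij C(1) c [of k] by auto
  qed
  moreover have "mat_chebG n s B (Suc (Suc k)) $$ (j, j) = chebG n s (B $$ (j, j)) (Suc (Suc k))"
    if "j < m" for j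
  proof -
    have "mat_chebG n s B (Suc (Suc k)) $$ (j, j) = ?C $$ (j, j) - n * mat_chebG n s B k $$ (j, j)"
      using that C(1) c [of k] by auto
    then show ?thesis
      using upper_triangular_mult(2) [OF B c [of "Suc k"]] ge2 that by simp
  qed
  ultimately show ?case by blast
qed

text \<open>Schur triangularization turns the hypotheses on matrices into those of
  \<open>multiplicity_formula\<close> for the diagonal entries. As multiplicities are integers, the
  formula is an integer quadratic equation for each root.\<close>

theorem mat_chebG_bound:
  fixes s t v D :: nat and A :: "complex mat"
  defines "n \<equiv> s * t"
  assumes A: "A \<in> carrier_mat v v" and pos: "v > 0" "s > 0" "t > 0" "D > 0" and n1: "n \<noteq> 1"
    and tr: "\<And>i. i \<le> D \<Longrightarrow> (\<Sum>j<v. mat_chebG n s A i $$ (j, j)) = v"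
    and ann: "A * mat_chebG n s A D = (of_nat (1 + n) :: complex) \<cdot>\<^sub>m mat_chebG n s A D"
  shows "D \<le> 12"
proof -
  let ?F = "mat_chebG n s A"
  obtain es where es: "char_poly A = (\<Prod>e\<leftarrow>es. [:- e, 1:])"
    using char_poly_factorized [OF A] by blast
  obtain B P Q where "schur_decomposition A es = (B, P, Q)" by (metis surj_pair)
  from schur_decomposition [OF A es this]
  have sim: "similar_mat_wit A B P Q" and ut: "upper_triangular B" and diag: "diag_mat B = es" by auto
  note S = similar_mat_witD2 [OF A sim]
  let ?R = "mat_chebG n s B"
  have B: "B \<in> carrier_mat v v" and R: "?R i \<in> carrier_mat v v" for i using S by auto
  have F: "?F i = P * ?R i * Q" for i by (rule mat_chebG_similar [OF A sim])
  have cancel: "P * (Q * X) = X" "Q * (P * X) = X" if "X \<in> carrier_mat v v" for X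
    using assoc_mult_mat [of P v v Q v X v] assoc_mult_mat [of Q v v P v X v] S that by simp_all
  have R_F: "?R i = Q * ?F i * P" for i
  proof -
    have RQ: "?R i * Q \<in> carrier_mat v v" using S(7) R [of i] by simp
    have "Q * ?F i = Q * (P * (?R i * Q))"
      unfolding F using assoc_mult_mat [OF S(6) R [of i] S(7)] by simp
    also have "\<dots> = ?R i * Q" by (rule cancel(2) [OF RQ])
    finally have "Q * ?F i * P = ?R i * (Q * P)"
      using assoc_mult_mat [OF R [of i] S(7) S(6)] by simp
    then show ?thesis using S(2) R [of i] by simp
  qed
  note T = mat_chebG_upper_triangular [OF B ut, of n s]
  have es': "es = map (\<lambda>j. B $$ (j, j)) [0..<v]"
    using diag B unfolding diag_mat_def by auto
  have trace: "(\<Sum>e\<leftarrow>es. chebG n s e i) = v" if "i \<le> D" for i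
  proof -
    have "(\<Sum>e\<leftarrow>es. chebG n s e i) = (\<Sum>j<v. ?R i $$ (j, j))"
      using T unfolding es' by (simp add: comp_def interv_sum_list_conv_sum_set_nat atLeast0LessThan)
    also have "\<dots> = (\<Sum>j<v. (Q * (?F i * P)) $$ (j, j))"
      using R_F S(5-) A by (simp add: assoc_mult_mat [of _ v v _ v _ v] mult_carrier_mat [of _ v v _ v])
    also have "\<dots> = (\<Sum>j<v. ((?F i * P) * Q) $$ (j, j))"
      using S(5-) A by (intro sum_diag_mult_commute mult_carrier_mat [of _ v v]) auto
    also have "(?F i * P) * Q = ?F i"
      using assoc_mult_mat [OF mat_chebG_carrier [OF A] S(6,7)] S(1)
        right_mult_one_mat [OF mat_chebG_carrier [OF A]] by simp
    finally show ?thesis using tr that by simp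
  qed
  have "B * ?R D = (of_nat (1 + n) :: complex) \<cdot>\<^sub>m ?R D"
  proof -
    have BQ: "B = Q * A * P" using similar_mat_witD2(3) [OF B similar_mat_wit_sym [OF sim]] .
    have FP: "?F D * P \<in> carrier_mat v v"
      by (rule mult_carrier_mat [OF mat_chebG_carrier [OF A] S(6)])
    have "B * ?R D = (Q * A * P) * (Q * ?F D * P)" by (simp only: R_F flip: BQ)
    also have "\<dots> = Q * (A * ?F D) * P"
      using S(5-) A cancel(1) [OF FP] by (simp add: assoc_mult_mat [of _ v v _ v _ v] mult_carrier_mat [of _ v v _ v])
    finally have "B * ?R D = Q * (A * ?F D) * P" .
    also have "\<dots> = (of_nat (1 + n) :: complex) \<cdot>\<^sub>m (Q * ?F D * P)"
      unfolding ann using S(5-) A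
      by (simp add: mult_smult_distrib [of _ v v _ v] mult_smult_assoc_mat [of _ v v _ v])
    finally show ?thesis using R_F by simp
  qed
  then have ann': "(e - (1 + n)) * chebG n s e D = 0" if e: "e \<in> set es" for e
  proof -
    obtain j where j: "j < v" "e = B $$ (j, j)" using e unfolding es' by auto
    have "(B * ?R D) $$ (j, j) = ((of_nat (1 + n) :: complex) \<cdot>\<^sub>m ?R D) $$ (j, j)" by (simp only: \<open>B * ?R D = _\<close>)
    then have "e * chebG n s e D = (1 + n) * chebG n s e D"
      using j T [of D] upper_triangular_mult(2) [OF B ut R, of D j] R [of D] by simp
    then show ?thesis by (simp add: algebra_simps)
  qed
  have quad: "\<exists>(a :: int) (b :: int) (c :: int). \<not> (a = 0 \<and> b = 0 \<and> c = 0) \<and> a * z\<^sup>2 + b * z + c = 0"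
    if "cheb n z (Suc D) + s * cheb n z D = 0" for z :: complex
  proof -
    have z: "chebG n s z D = 0" using that by (simp add: chebG_eq_cheb)
    \<comment> \<open>\<open>m = 0\<close> is allowed: the equation then has leading coefficient
      \<open>v * (t + 1)\<close>.\<close>
    define m where "m = count_list es z"
    define L where "L = 2 * t * (D + 1) + 2 * D * s"
    define E where "E = 2 * D + 1"
    have eq: "of_nat m * (1 + n - z) * (L + E * z) = v * (t + 1) * (4 * n - z\<^sup>2)"
      using multiplicity_formula [of s t D es v z] trace ann' z pos
      unfolding n_def m_def L_def E_def by (simp add: add.commute)
    define a where "a = int v * (int t + 1) - int m * int E"
    define b where "b = int m * ((1 + int n) * int E - int L)"
    define c where "c = int m * (1 + int n) * int L - 4 * int n * int v * (int t + 1)"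
    have "\<not> (a = 0 \<and> b = 0 \<and> c = 0)"
    proof
      assume abc: "a = 0 \<and> b = 0 \<and> c = 0"
      have "int v * (int t + 1) = int m * int E" using abc by (simp add: a_def)
      moreover have "int v * (int t + 1) > 0" using pos by simp
      ultimately have m: "m > 0" by (cases m) auto
      then have L: "int L = (1 + int n) * int E" using abc by (simp add: b_def)
      \<comment> \<open>If all coefficients vanished, \<open>(1 + n - z) * (L + E * z)\<close> would
        be proportional to \<open>4 * n - z\<^sup>2\<close>, which forces
        \<open>(n - 1)\<^sup>2 = 0\<close>.\<close>
      have "int m * (int E * ((1 + int n)\<^sup>2 - 4 * int n)) = c + 4 * int n * a"
        by (simp add: a_def c_def L power2_eq_square algebra_simps)
      then have "(1 + int n)\<^sup>2 - 4 * int n = 0" using abc m by (simp add: E_def)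
      then have "(int n - 1)\<^sup>2 = 0" by (simp add: power2_eq_square algebra_simps)
      then show False using n1 by simp
    qed
    moreover have "a * z\<^sup>2 + b * z + c = 0"
      using eq by (simp add: a_def b_def c_def power2_eq_square algebra_simps)
    ultimately show ?thesis by blast
  qed
  show ?thesis
    by (rule cheb_root_bound [of "int s" "int t"]) (use quad pos in \<open>auto simp: n_def\<close>)
qed

section \<open>Distances and cycles in graphs\<close>

locale connected_pair_graph = pair_graph +
  assumes conn: "Digraph_Component.connected (with_proj G)"
begin

abbreviation "dist_G \<equiv> distance G"

lemma sym_arc: "(u, v) \<in> parcs G \<Longrightarrow> (v, u) \<in> parcs G"
  using arcs_symmetric by blast

lemma arc_verts: "(u, v) \<in> parcs G \<Longrightarrow> u \<in> pverts G \<and> v \<in> pverts G"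
  using in_arcsD1 in_arcsD2 by blast

lemma awalk_exists:
  assumes "u \<in> pverts G" "v \<in> pverts G"
  obtains p where "awalk u p v"
proof -
  \<comment> \<open>Connectedness is defined by the symmetric closure, which adds no arcs
    here.\<close>
  have "u \<rightarrow>\<^sup>*\<^bsub>with_proj (mk_symmetric (with_proj G))\<^esub> v"
    using conn assms by (auto simp: connected_def strongly_connected_def)
  then have "u \<rightarrow>\<^sup>*\<^bsub>with_proj G\<^esub> v"
    using reachable_mk_symmetric_eq [OF pair_sym_arcs] by simp
  then show ?thesis using that by (auto simp: reachable_awalk)
qed

lemma distance_awalk:
  assumes "u \<in> pverts G" "v \<in> pverts G"
  obtains p where "awalk u p v" "length p = dist_G u v"
proof -
  obtain q where "awalk u q v" using assms by (rule awalk_exists)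
  then have "\<exists>n p. awalk u p v \<and> length p = n" by blast
  then have "\<exists>p. awalk u p v \<and> length p = dist_G u v"
    unfolding distance_def by (rule LeastI_ex)
  then show ?thesis using that by blast
qed

lemma distance_le: "awalk u p v \<Longrightarrow> dist_G u v \<le> length p"
  unfolding distance_def by (rule Least_le) blast

lemma distance_self [simp]: "u \<in> pverts G \<Longrightarrow> dist_G u u = 0"
  using distance_le [of u "[]" u] by (simp add: awalk_Nil_iff)

lemma distance_eq_0:
  assumes "u \<in> pverts G" "v \<in> pverts G"
  shows "dist_G u v = 0 \<longleftrightarrow> u = v"
proof
  assume "dist_G u v = 0"
  then obtain p where "awalk u p v" "length p = 0" using distance_awalk [OF assms] by metis
  then show "u = v" by (simp add: awalk_Nil_iff)
qed (use assms in simp)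

lemma length_rev_path: "length (rev_path p) = length p"
  by (induction p) auto

lemma distance_sym:
  assumes "u \<in> pverts G" "v \<in> pverts G"
  shows "dist_G u v = dist_G v u"
proof -
  have "dist_G v u \<le> dist_G u v" if uv: "u \<in> pverts G" "v \<in> pverts G" for u v
  proof -
    obtain p where "awalk u p v" "length p = dist_G u v" using uv by (rule distance_awalk)
    then show ?thesis using distance_le [of v "rev_path p" u] by (simp add: length_rev_path)
  qed
  then show ?thesis using assms by (metis order_antisym)
qed

lemma distance_arc:
  assumes "(u, w) \<in> parcs G" "v \<in> pverts G"
  shows "dist_G u v \<le> dist_G w v + 1"
proof -
  have w: "w \<in> pverts G" using assms(1) arc_verts by blast
  then obtain p where "awalk w p v" "length p = dist_G w v" using assms(2) by (rule distance_awalk)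
  then show ?thesis
    using distance_le [of u "(u, w) # p" v] assms(1) by (simp add: awalk_Cons_iff)
qed

lemma distance_closer:
  assumes "u \<in> pverts G" "v \<in> pverts G" "dist_G u v = Suc k"
  obtains w where "(u, w) \<in> parcs G" "dist_G w v = k"
proof -
  obtain p where p: "awalk u p v" "length p = Suc k"
    using distance_awalk [OF assms(1,2)] assms(3) by metis
  then obtain e es where "p = e # es" by (cases p) auto
  then obtain w where uw: "(u, w) \<in> parcs G" "awalk w es v" "length es = k"
    using p by (cases e) (auto simp: awalk_Cons_iff)
  then have "dist_G w v \<le> k" using distance_le by metis
  moreover have "Suc k \<le> dist_G w v + 1" using distance_arc [OF uw(1) assms(2)] assms(3) by simp
  ultimately show ?thesis using that uw(1) by simp
qed

lemma geodesic:
  assumes "u \<in> pverts G" "v \<in> pverts G" "dist_G u v = n"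
  shows "\<exists>f. f 0 = u \<and> (\<forall>j\<le>n. f j \<in> pverts G \<and> dist_G (f j) v = n - j) \<and> (\<forall>j<n. (f j, f (Suc j)) \<in> parcs G)"
  using assms(1,3)
proof (induction n arbitrary: u)
  case 0
  then show ?case by (intro exI [of _ "\<lambda>_. u"]) auto
next
  case (Suc n)
  obtain w where w: "(u, w) \<in> parcs G" "dist_G w v = n"
    using distance_closer [OF Suc.prems(1) assms(2) Suc.prems(2)] .
  then obtain f where f: "f 0 = w" "\<forall>j\<le>n. f j \<in> pverts G \<and> dist_G (f j) v = n - j"
    "\<forall>j<n. (f j, f (Suc j)) \<in> parcs G"
    using Suc.IH arc_verts by metis
  let ?g = "case_nat u f"
  have "?g j \<in> pverts G \<and> dist_G (?g j) v = Suc n - j" if "j \<le> Suc n" for j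
    using f(2) Suc.prems that by (cases j) auto
  moreover have "(?g j, ?g (Suc j)) \<in> parcs G" if "j < Suc n" for j
    using f(1,3) w(1) that by (cases j) auto
  ultimately show ?case by (intro exI [of _ ?g]) auto
qed

lemma cycle_of_sequence:
  assumes "n > 0" "h n = h 0" "\<And>j. j < n \<Longrightarrow> (h j, h (Suc j)) \<in> parcs G" "inj_on h {1..n}"
  shows "cycle (map (\<lambda>j. (h j, h (Suc j))) [0..<n])"
proof -
  let ?p = "\<lambda>m. map (\<lambda>j. (h j, h (Suc j))) [0..<m]"
  have walk: "awalk (h 0) (?p m) (h m)" if "m \<le> n" for m
    using that
  proof (induction m)
    case 0
    then show ?case using assms(1) assms(3) [of 0] arc_verts by (auto simp: awalk_Nil_iff)
  next
    case (Suc m)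
    then have "awalk (h m) [(h m, h (Suc m))] (h (Suc m))"
      using assms(3) [of m] arc_verts by (auto simp: awalk_Cons_iff awalk_Nil_iff)
    then show ?case using Suc by simp
  qed
  have "pawalk_verts (h 0) (?p n) = map h [0..<n] @ [h n]"
    using awalk_verts_conv [of "h 0" "?p n"] assms(1) by (auto simp: last_map comp_def)
  also have "\<dots> = map h [0..<Suc n]" by simp
  finally have "tl (pawalk_verts (h 0) (?p n)) = map h [1..<Suc n]"
    by (simp add: upt_conv_Cons del: upt_Suc)
  moreover have "distinct (map h [1..<Suc n])"
    using assms(4) by (simp add: distinct_map atLeastLessThanSuc_atLeastAtMost del: upt_Suc)
  ultimately show ?thesis
    using walk [of n] assms(1,2) unfolding cycle_def by auto
qed

text \<open>The geodesics through \<open>y\<close> and \<open>y'\<close> are closed up at their first common vertex.\<close>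
lemma two_geodesics_cycle:
  assumes x: "(x, y) \<in> parcs G" "(x, y') \<in> parcs G" and v: "v \<in> pverts G"
    and "y \<noteq> y'" "dist_G x v = Suc k" "dist_G y v = k" "dist_G y' v = k"
  obtains c where "cycle c" "3 \<le> length c" "length c \<le> 2 * Suc k"
proof -
  obtain f0 where f0: "f0 0 = y" "\<forall>j\<le>k. f0 j \<in> pverts G \<and> dist_G (f0 j) v = k - j"
    "\<forall>j<k. (f0 j, f0 (Suc j)) \<in> parcs G"
    using geodesic [of y v k] assms arc_verts by blast
  obtain g0 where g0: "g0 0 = y'" "\<forall>j\<le>k. g0 j \<in> pverts G \<and> dist_G (g0 j) v = k - j"
    "\<forall>j<k. (g0 j, g0 (Suc j)) \<in> parcs G"
    using geodesic [of y' v k] assms arc_verts by blast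
  define f where "f = case_nat x f0"
  define g where "g = case_nat x g0"
  have xV: "x \<in> pverts G" using x arc_verts by blast
  have fd: "dist_G (f j) v = Suc k - j" "dist_G (g j) v = Suc k - j" "f j \<in> pverts G" "g j \<in> pverts G"
    if "j \<le> Suc k" for j
    using that f0(2) g0(2) assms(5) xV by (cases j; simp add: f_def g_def)+
  have arc: "(f j, f (Suc j)) \<in> parcs G" "(g j, g (Suc j)) \<in> parcs G" if "j < Suc k" for j
    using that f0(1,3) g0(1,3) x by (cases j; simp add: f_def g_def)+
  have "f (Suc k) = v" "g (Suc k) = v"
    using fd [of "Suc k"] v distance_eq_0 by auto
  then have ex: "\<exists>i. 0 < i \<and> f i = g i" by (metis zero_less_Suc)
  \<comment> \<open>Equal indices lie at equal distance from \<open>v\<close>, and both sequences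
    end in \<open>v\<close>, so they meet.\<close>
  define i where "i = (LEAST i. 0 < i \<and> f i = g i)"
  have i: "0 < i" "f i = g i" using LeastI_ex [OF ex] by (auto simp: i_def)
  have min: "f j \<noteq> g j" if "0 < j" "j < i" for j
    using not_less_Least [of j "\<lambda>i. 0 < i \<and> f i = g i"] that by (auto simp: i_def)
  have ik: "i \<le> Suc k"
    unfolding i_def using \<open>f (Suc k) = v\<close> \<open>g (Suc k) = v\<close> by (intro Least_le) auto
  have "f 1 \<noteq> g 1" using assms(4) f0(1) g0(1) by (simp add: f_def g_def)
  then have i2: "i \<ge> 2" using i by (metis One_nat_def Suc_leI le_neq_implies_less numeral_2_eq_2)
  \<comment> \<open>Out along \<open>f\<close> to the meeting vertex and back along
    \<open>g\<close>; the length \<open>2 * i\<close> is at least 4.\<close>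
  define h where "h j = (if j \<le> i then f j else g (2 * i - j))" for j
  have g_eq: "g 0 = f 0" by (simp add: f_def g_def)
  have "cycle (map (\<lambda>j. (h j, h (Suc j))) [0..<2 * i])"
  proof (rule cycle_of_sequence)
    show "0 < 2 * i" using i by simp
    show "h (2 * i) = h 0" using i g_eq by (simp add: h_def)
    show "(h j, h (Suc j)) \<in> parcs G" if "j < 2 * i" for j
    proof (cases "j < i")
      case True
      then show ?thesis using arc(1) [of j] ik by (simp add: h_def)
    next
      case False
      then have "h j = g (2 * i - j)" using i(2) by (cases "j = i") (auto simp: h_def)
      moreover have "h (Suc j) = g (2 * i - Suc j)" using False by (simp add: h_def)
      moreover have "2 * i - j = Suc (2 * i - Suc j)" using that by simp
      moreover have "2 * i - Suc j < Suc k" using False ik by linarith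
      ultimately show ?thesis using arc(2) [of "2 * i - Suc j"] sym_arc by simp
    qed
    show "inj_on h {1..2 * i}"
    proof (rule inj_onI)
      fix a b assume ab: "a \<in> {1..2 * i}" "b \<in> {1..2 * i}" "h a = h b"
      \<comment> \<open>The distance to \<open>v\<close> recovers the level, so a repeated vertex
        would be an earlier meeting of the two geodesics.\<close>
      have hd: "dist_G (h a) v = Suc k - (if a \<le> i then a else 2 * i - a)" if "a \<le> 2 * i" for a
        using that fd ik by (auto simp: h_def)
      have "Suc k - (if a \<le> i then a else 2 * i - a) = Suc k - (if b \<le> i then b else 2 * i - b)"
        using hd ab by (metis atLeastAtMost_iff)
      then have eq: "(if a \<le> i then a else 2 * i - a) = (if b \<le> i then b else 2 * i - b)"
        using ik ab by (auto split: if_splits)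
      have no: False if "a \<le> i" "i < b" "h a = h b" "a = 2 * i - b" "1 \<le> a" for a b
      proof -
        have "f a = g a" using that by (simp add: h_def)
        moreover have "a < i" using that by simp
        moreover have "0 < a" using that by simp
        ultimately show False using min by blast
      qed
      show "a = b"
      proof (cases "a \<le> i"; cases "b \<le> i")
        assume "a \<le> i" "\<not> b \<le> i"
        then show ?thesis using no [of a b] eq ab by auto
      next
        assume "\<not> a \<le> i" "b \<le> i"
        then show ?thesis using no [of b a] eq ab by auto
      qed (use eq ab in auto)
    qed
  qed
  then show ?thesis using that [of "map (\<lambda>j. (h j, h (Suc j))) [0..<2 * i]"] i2 ik by simp
qed

lemma girth_le:
  assumes "cycle c" "3 \<le> length c"
  shows "girth G \<le> enat (length c)"
  unfolding girth_def by (rule INF_lower) (use assms in simp)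

lemma girth_ge_3: "enat 3 \<le> girth G"
  unfolding girth_def by (rule INF_greatest) simp

text \<open>Two such neighbours would close a cycle of length at most
  \<open>2 * Suc k\<close>.\<close>

lemma closer_neighbour_unique:
  assumes "(x, y) \<in> parcs G" "(x, y') \<in> parcs G" "v \<in> pverts G"
    and "dist_G x v = Suc k" "dist_G y v = k" "dist_G y' v = k" "enat (2 * Suc k) < girth G"
  shows "y = y'"
proof (rule ccontr)
  assume "y \<noteq> y'"
  then obtain c where "cycle c" "3 \<le> length c" "length c \<le> 2 * Suc k"
    using two_geodesics_cycle [OF assms(1-3)] assms(4-6) by blast
  then have "girth G \<le> enat (2 * Suc k)" using girth_le by (meson enat_ord_simps(1) order_trans)
  then show False using assms(7) by simp
qed

lemma distance_le_eccentricity: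
  "v \<in> pverts G \<Longrightarrow> dist_G u v \<le> eccentricity G u"
  unfolding eccentricity_def using pair_finite_verts by (intro Max_ge) auto

lemma eccentricity_attained:
  assumes "u \<in> pverts G"
  obtains v where "v \<in> pverts G" "dist_G u v = eccentricity G u"
proof -
  have "eccentricity G u \<in> dist_G u ` pverts G"
    unfolding eccentricity_def using pair_finite_verts assms by (intro Max_in) auto
  then show ?thesis using that by auto
qed

lemma eccentricity_arc:
  assumes "(u, w) \<in> parcs G"
  shows "eccentricity G u \<le> eccentricity G w + 1"
proof -
  obtain v where v: "v \<in> pverts G" "dist_G u v = eccentricity G u"
    using eccentricity_attained assms arc_verts by metis
  then show ?thesis
    using distance_arc [OF assms v(1)] distance_le_eccentricity [OF v(1), of w] by linarith
qed

end

section \<open>The collinearity graph\<close>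

context connected_pair_graph
begin

abbreviation nbr :: "'a \<Rightarrow> 'a set" where "nbr u \<equiv> {w. (u, w) \<in> parcs G}"

lemma finite_nbr: "finite (nbr u)"
proof -
  have "nbr u \<subseteq> pverts G" using arc_verts by blast
  then show ?thesis using pair_finite_verts by (rule finite_subset)
qed

lemma distance_1:
  assumes "u \<in> pverts G" "v \<in> pverts G"
  shows "dist_G u v = 1 \<longleftrightarrow> (u, v) \<in> parcs G"
proof
  assume "dist_G u v = 1"
  then obtain w where "(u, w) \<in> parcs G" "dist_G w v = 0"
    using distance_closer [OF assms] by (metis One_nat_def)
  then show "(u, v) \<in> parcs G" using distance_eq_0 arc_verts assms by metis
next
  assume uv: "(u, v) \<in> parcs G"
  then have "dist_G u v \<le> 1" using distance_arc [OF uv assms(2)] assms by simp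
  moreover have "u \<noteq> v" using uv no_loops' by blast
  ultimately show "dist_G u v = 1" using distance_eq_0 assms by (metis le_antisym One_nat_def Suc_leI neq0_conv)
qed

lemma sphere_1: "u \<in> pverts G \<Longrightarrow> sphere G 1 u = nbr u"
  unfolding sphere_def using distance_1 arc_verts by blast

end

locale bipartite_pair_graph = connected_pair_graph +
  fixes P Q :: "'a set"
  assumes classes: "P \<union> Q = pverts G" "P \<inter> Q = {}" "parcs G \<subseteq> P \<times> Q \<union> Q \<times> P"
begin

lemma distance_parity:
  assumes "u \<in> pverts G" "v \<in> pverts G"
  shows "even (dist_G u v) \<longleftrightarrow> (u \<in> P \<longleftrightarrow> v \<in> P)"
  using assms(1)
proof (induction "dist_G u v" arbitrary: u)
  case 0
  then have "u = v" using distance_eq_0 assms(2) by metis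
  then show ?case using assms(2) by simp
next
  case (Suc k)
  obtain w where w: "(u, w) \<in> parcs G" "dist_G w v = k"
    using distance_closer [OF Suc.prems assms(2)] Suc.hyps(2) by metis
  then have "even k \<longleftrightarrow> (w \<in> P \<longleftrightarrow> v \<in> P)" using Suc.hyps(1) [of w] arc_verts by metis
  moreover have "u \<in> P \<longleftrightarrow> w \<notin> P" using w(1) classes by blast
  ultimately show ?case using Suc.hyps(2) by (metis even_Suc)
qed

lemma distance_nbr:
  assumes "(u, w) \<in> parcs G" "v \<in> pverts G"
  shows "dist_G w v = dist_G u v + 1 \<or> dist_G u v = dist_G w v + 1"
proof -
  have u: "u \<in> pverts G" "w \<in> pverts G" "u \<in> P \<longleftrightarrow> w \<notin> P"
    using assms(1) arc_verts classes by blast+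
  then have "even (dist_G u v) \<longleftrightarrow> odd (dist_G w v)" using distance_parity assms(2) by metis
  then have "dist_G u v \<noteq> dist_G w v" by metis
  moreover have "dist_G u v \<le> dist_G w v + 1" "dist_G w v \<le> dist_G u v + 1"
    using distance_arc assms sym_arc by blast+
  ultimately show ?thesis by linarith
qed

lemma nbr_P: "u \<in> P \<Longrightarrow> l \<in> nbr u \<Longrightarrow> l \<in> Q" and nbr_Q: "l \<in> Q \<Longrightarrow> x \<in> nbr l \<Longrightarrow> x \<in> P"
  using classes by blast+

end

section \<open>Moore geometries\<close>

text \<open>\<open>P\<close> are the points and \<open>Q\<close> the lines, with
  \<open>s + 1\<close> points on a line and \<open>t + 1\<close> lines through a point.
  \<open>unique\<close> expresses the girth condition; \<open>s * t \<noteq> 1\<close> excludes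
  ordinary polygons.\<close>

locale bipartite_moore_graph = bipartite_pair_graph +
  fixes s t D :: nat
  assumes degree_P: "\<And>p. p \<in> P \<Longrightarrow> card {w. (p, w) \<in> parcs G} = t + 1"
    and degree_Q: "\<And>l. l \<in> Q \<Longrightarrow> card {w. (l, w) \<in> parcs G} = s + 1"
    and unique: "\<And>x y y' v k. (x, y) \<in> parcs G \<Longrightarrow> (x, y') \<in> parcs G \<Longrightarrow> v \<in> pverts G \<Longrightarrow>
      distance G x v = Suc k \<Longrightarrow> distance G y v = k \<Longrightarrow> distance G y' v = k \<Longrightarrow> Suc k \<le> 2 * D \<Longrightarrow> y = y'"
    and ecc_P: "\<And>p v. p \<in> P \<Longrightarrow> v \<in> pverts G \<Longrightarrow> distance G p v \<le> 2 * D + 1"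
    and nondegenerate: "P \<noteq> {}" "s > 0" "t > 0" "s * t \<noteq> 1" "D > 0"
begin

lemma finite_P: "finite P"
  using pair_finite_verts classes(1) by (auto intro: finite_subset)

text \<open>By \<open>unique\<close> at distance 2, two lines through \<open>u\<close> share no
  other point, so collinear points can be counted line by line. The later counts differ only in
  \<open>R\<close>.\<close>

lemma card_collinear:
  assumes u: "u \<in> P"
  shows "card {x \<in> P. dist_G u x = 2 \<and> R x} = (\<Sum>l\<in>nbr u. card {x \<in> nbr l - {u}. R x})"
proof -
  have V: "u \<in> pverts G" using u classes by blast
  have dist2: "x \<in> P \<and> x \<in> pverts G \<and> dist_G u x = 2 \<and> dist_G l x = 1" if "l \<in> nbr u" "x \<in> nbr l - {u}" for l x
  proof -
    have x: "x \<in> P" "x \<in> pverts G" using that nbr_P [OF u] nbr_Q classes by blast+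
    have lx: "dist_G l x = 1" using that distance_1 arc_verts by blast
    then have "dist_G u x = 2 \<or> dist_G u x = 0" using distance_nbr [of u l x] that x by auto
    then show ?thesis using lx x V distance_eq_0 that by auto
  qed
  have "{x \<in> P. dist_G u x = 2 \<and> R x} = (\<Union>l\<in>nbr u. {x \<in> nbr l - {u}. R x})"
  proof (intro equalityI subsetI)
    fix x assume "x \<in> {x \<in> P. dist_G u x = 2 \<and> R x}"
    then have x: "x \<in> pverts G" "dist_G u x = Suc 1" "R x" using classes by auto
    then obtain l where l: "(u, l) \<in> parcs G" "dist_G l x = 1" using distance_closer [OF V] by metis
    then have "(l, x) \<in> parcs G" using distance_1 arc_verts x(1) by blast
    moreover have "x \<noteq> u" using x V by auto
    ultimately show "x \<in> (\<Union>l\<in>nbr u. {x \<in> nbr l - {u}. R x})" using l x by blast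
  qed (use dist2 in auto)
  moreover have "{x \<in> nbr l - {u}. R x} \<inter> {x \<in> nbr l' - {u}. R x} = {}"
    if ll: "l \<in> nbr u" "l' \<in> nbr u" "l \<noteq> l'" for l l'
  proof (rule ccontr)
    assume "\<not> ?thesis"
    then obtain x where x: "x \<in> nbr l - {u}" "x \<in> nbr l' - {u}" by blast
    have "l = l'"
      using unique [of u l l' x 1] dist2 [OF ll(1) x(1)] dist2 [OF ll(2) x(2)] ll nondegenerate(5) by auto
    then show False using ll by simp
  qed
  ultimately show ?thesis using finite_nbr by (simp add: card_UN_disjoint)
qed

lemma card_nbr_minus:
  assumes "u \<in> P" "l \<in> nbr u"
  shows "card (nbr l - {u}) = s"
  using degree_Q [OF nbr_P [OF assms]] sym_arc assms finite_nbr by (subst card_Diff_singleton) auto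

lemma card_collinear_all:
  assumes u: "u \<in> P" and "\<And>x. x \<in> P \<Longrightarrow> dist_G u x = 2 \<Longrightarrow> R x"
  shows "card {x \<in> P. dist_G u x = 2 \<and> R x} = s * (t + 1)"
proof -
  have "{x \<in> P. dist_G u x = 2 \<and> R x} = {x \<in> P. dist_G u x = 2 \<and> True}" using assms(2) by auto
  also have "card \<dots> = (\<Sum>l\<in>nbr u. card {x \<in> nbr l - {u}. True})" by (rule card_collinear [OF u])
  also have "\<dots> = (\<Sum>l\<in>nbr u. s)"
  proof (rule sum.cong)
    fix l assume l: "l \<in> nbr u"
    have "{x \<in> nbr l - {u}. True} = nbr l - {u}" by blast
    then show "card {x \<in> nbr l - {u}. True} = s" using card_nbr_minus [OF u l] by (simp only:)
  qed simp
  also have "\<dots> = s * (t + 1)" using degree_P [OF u] by simp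
  finally show ?thesis .
qed

lemma sum_single:
  assumes "finite A" "a \<in> A" "\<And>x. x \<in> A \<Longrightarrow> x \<noteq> a \<Longrightarrow> f x = (0 :: nat)"
  shows "sum f A = f a"
  using sum.mono_neutral_right [of A "{a}" f] assms by auto

text \<open>All points of the line through \<open>u\<close> nearest to \<open>v\<close> qualify. On
  any other line through \<open>u\<close>, at distance \<open>2 * i + 1\<close>, \<open>u\<close> is
  the unique nearest point; this uniqueness requires \<open>i < D\<close>.\<close>

lemma card_collinear_same:
  assumes u: "u \<in> P" and v: "v \<in> P" and i: "dist_G u v = 2 * i" "0 < i" "i < D"
  shows "card {x \<in> P. dist_G u x = 2 \<and> dist_G x v \<le> 2 * i} = s"
proof -
  have V: "u \<in> pverts G" "v \<in> pverts G" using u v classes by blast+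
  obtain l0 where l0: "(u, l0) \<in> parcs G" "dist_G l0 v = 2 * i - 1"
    using distance_closer [OF V, of "2 * i - 1"] i by auto
  have "card {x \<in> nbr l - {u}. dist_G x v \<le> 2 * i} = 0" if l: "l \<in> nbr u" "l \<noteq> l0" for l
  proof -
    have "dist_G l v \<noteq> 2 * i - 1"
      using unique [of u l l0 v "2 * i - 1"] l l0 V i by auto
    then have dl: "dist_G l v = Suc (2 * i)" using distance_nbr [of u l v] l V i by auto
    have "\<not> dist_G x v \<le> 2 * i" if x: "x \<in> nbr l - {u}" for x
    proof
      assume "dist_G x v \<le> 2 * i"
      then have "dist_G x v = 2 * i" using distance_nbr [of l x v] x V dl by auto
      then have "x = u" using unique [of l x u v "2 * i"] x l sym_arc V dl i by auto
      then show False using x by simp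
    qed
    then have "{x \<in> nbr l - {u}. dist_G x v \<le> 2 * i} = {}" by blast
    then show ?thesis by (simp only: card.empty)
  qed
  then have "(\<Sum>l\<in>nbr u. card {x \<in> nbr l - {u}. dist_G x v \<le> 2 * i})
      = card {x \<in> nbr l0 - {u}. dist_G x v \<le> 2 * i}"
    using l0 finite_nbr by (intro sum_single) auto
  also have "{x \<in> nbr l0 - {u}. dist_G x v \<le> 2 * i} = nbr l0 - {u}"
    using distance_nbr [OF _ V(2), of l0] l0 i by fastforce
  also have "card \<dots> = s" using l0 by (intro card_nbr_minus [OF u]) simp
  finally show ?thesis using card_collinear [OF u] by simp
qed

text \<open>One line through \<open>u\<close> leads towards \<open>v\<close>, and one point on it is
  closer to \<open>v\<close>; the other lines are at distance \<open>2 * i + 3\<close>.\<close>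

lemma card_collinear_next:
  assumes u: "u \<in> P" and v: "v \<in> P" and i: "dist_G u v = 2 * Suc i" "Suc i \<le> D"
  shows "card {x \<in> P. dist_G u x = 2 \<and> dist_G x v \<le> 2 * i} = 1"
proof -
  have V: "u \<in> pverts G" "v \<in> pverts G" using u v classes by blast+
  obtain l0 where l0: "(u, l0) \<in> parcs G" "dist_G l0 v = Suc (2 * i)"
    using distance_closer [OF V, of "Suc (2 * i)"] i by auto
  then have l0V: "l0 \<in> pverts G" using arc_verts by blast
  have "card {x \<in> nbr l - {u}. dist_G x v \<le> 2 * i} = 0" if l: "l \<in> nbr u" "l \<noteq> l0" for l
  proof -
    have "dist_G l v \<noteq> Suc (2 * i)"
      using unique [of u l l0 v "Suc (2 * i)"] l l0 V i by auto
    then have dl: "dist_G l v = 2 * i + 3" using distance_nbr [of u l v] l V i by auto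
    have "\<not> dist_G x v \<le> 2 * i" if x: "x \<in> nbr l - {u}" for x
      using distance_nbr [of l x v] x V dl by auto
    then have "{x \<in> nbr l - {u}. dist_G x v \<le> 2 * i} = {}" by blast
    then show ?thesis by (simp only: card.empty)
  qed
  then have "(\<Sum>l\<in>nbr u. card {x \<in> nbr l - {u}. dist_G x v \<le> 2 * i})
      = card {x \<in> nbr l0 - {u}. dist_G x v \<le> 2 * i}"
    using l0 finite_nbr by (intro sum_single) auto
  also have "\<dots> = 1"
  proof -
    obtain x where x: "(l0, x) \<in> parcs G" "dist_G x v = 2 * i"
      using distance_closer [OF l0V V(2) l0(2)] .
    have uniq: "y = x" if "(l0, y) \<in> parcs G" "dist_G y v \<le> 2 * i" for y
    proof -
      have "dist_G y v = 2 * i" using distance_nbr [OF that(1) V(2)] that(2) l0(2) by auto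
      then show ?thesis using unique [OF that(1) x(1) V(2) l0(2)] x(2) i(2) by simp
    qed
    have "x \<noteq> u" "dist_G x v \<le> 2 * i" using x(2) i(1) by auto
    then have "{y \<in> nbr l0 - {u}. dist_G y v \<le> 2 * i} = {x}" using uniq x(1) by blast
    then show ?thesis by simp
  qed
  finally show ?thesis using card_collinear [OF u] by simp
qed

lemma distance_triangle_2:
  assumes "u \<in> P" "x \<in> P" "dist_G u x = 2" "v \<in> pverts G"
  shows "dist_G u v \<le> dist_G x v + 2" "dist_G x v \<le> dist_G u v + 2"
proof -
  have V: "u \<in> pverts G" "x \<in> pverts G" using assms classes by blast+
  then obtain l where l: "(u, l) \<in> parcs G" "dist_G l x = 1"
    using distance_closer [of u x 1] assms(3) by auto
  then have "(l, x) \<in> parcs G" using distance_1 V arc_verts by blast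
  then show "dist_G u v \<le> dist_G x v + 2" "dist_G x v \<le> dist_G u v + 2"
    using distance_nbr [OF l(1) assms(4)] distance_nbr [of l x v] assms(4) by auto
qed

lemma distance_P_le: "u \<in> P \<Longrightarrow> v \<in> P \<Longrightarrow> \<exists>j\<le>D. dist_G u v = 2 * j"
proof -
  assume "u \<in> P" "v \<in> P"
  moreover from this have "even (dist_G u v)" using distance_parity classes by blast
  moreover have "dist_G u v \<le> 2 * D + 1" using ecc_P calculation(1,2) classes by blast
  ultimately show ?thesis by (auto elim!: evenE)
qed

text \<open>The matrix \<open>A + (1 - s) I\<close>, with \<open>A\<close> the adjacency matrix of collinearity, satisfies the recurrence of
  \<open>mat_chebG\<close> with the sums \<open>A\<^sub>0 + \<dots> + A\<^sub>i\<close> of the distance matrices.\<close>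
theorem half_diameter_bound: "D \<le> 12"
proof -
  define m where "m = card P"
  obtain f where f: "bij_betw f {0..<m} P"
    unfolding m_def using ex_bij_betw_nat_finite [OF finite_P] by blast
  have fP: "f i \<in> P" if "i < m" for i using f that by (auto simp: bij_betw_def)
  define W :: "complex mat" where
    "W = mat m m (\<lambda>(i, j). if dist_G (f i) (f j) = 2 then 1 else if i = j then 1 - of_nat s else 0)"
  define F :: "nat \<Rightarrow> complex mat" where
    "F k = mat m m (\<lambda>(i, j). if dist_G (f i) (f j) \<le> 2 * k then 1 else 0)" for k
  have W: "W \<in> carrier_mat m m" and F: "F k \<in> carrier_mat m m" for k by (simp_all add: W_def F_def)
  have f_self: "dist_G (f i) (f j) = 0 \<longleftrightarrow> i = j" if "i < m" "j < m" for i j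
  proof -
    have "f i \<in> pverts G" "f j \<in> pverts G" using fP that classes by blast+
    then have "dist_G (f i) (f j) = 0 \<longleftrightarrow> f i = f j" by (rule distance_eq_0)
    also have "\<dots> \<longleftrightarrow> i = j" using f that by (auto simp: bij_betw_def inj_on_def)
    finally show ?thesis .
  qed
  \<comment> \<open>Row \<open>i\<close> of \<open>W\<close> selects the points collinear with
    \<open>f i\<close>; the diagonal entry \<open>1 - s\<close> gives the second term.\<close>
  have WF: "(W * F k) $$ (i, j) =
      of_nat (card {x \<in> P. dist_G (f i) x = 2 \<and> dist_G x (f j) \<le> 2 * k})
      + (1 - of_nat s) * (if dist_G (f i) (f j) \<le> 2 * k then 1 else 0)"
    if ij: "i < m" "j < m" for i j k
  proof -
    let ?g = "\<lambda>x. if dist_G (f i) x = 2 \<and> dist_G x (f j) \<le> 2 * k then 1 else (0 :: complex)"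
    let ?c = "(1 - of_nat s) * (if dist_G (f i) (f j) \<le> 2 * k then 1 else 0) :: complex"
    have "(W * F k) $$ (i, j) = (\<Sum>l\<in>{0..<m}. W $$ (i, l) * F k $$ (l, j))"
      using ij W F [of k] by (auto simp: scalar_prod_def)
    also have "\<dots> = (\<Sum>l\<in>{0..<m}. ?g (f l) + (if l = i then ?c else 0))"
      using ij f_self [of i i] by (intro sum.cong) (auto simp: W_def F_def)
    also have "\<dots> = (\<Sum>l\<in>{0..<m}. ?g (f l)) + ?c" using ij by (simp add: sum.distrib)
    also have "(\<Sum>l\<in>{0..<m}. ?g (f l)) = (\<Sum>x\<in>P. ?g x)" by (rule sum.reindex_bij_betw [OF f])
    also have "\<dots> = of_nat (card {x \<in> P. dist_G (f i) x = 2 \<and> dist_G x (f j) \<le> 2 * k})"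
      using finite_P by (simp add: sum.If_cases Int_def)
    finally show ?thesis .
  qed
  have rec: "F (Suc (Suc k)) = W * F (Suc k) - of_nat (s * t) \<cdot>\<^sub>m F k" if "Suc (Suc k) \<le> D" for k
  proof (rule eq_matI)
    fix i j assume "i < dim_row (W * F (Suc k) - of_nat (s * t) \<cdot>\<^sub>m F k)"
      "j < dim_col (W * F (Suc k) - of_nat (s * t) \<cdot>\<^sub>m F k)"
    then have ij: "i < m" "j < m" using F [of k] by auto
    let ?u = "f i" and ?v = "f j"
    have uv: "?u \<in> P" "?v \<in> P" "?v \<in> pverts G" using fP ij classes by blast+
    obtain r where r: "r \<le> D" "dist_G ?u ?v = 2 * r" using distance_P_le uv by blast
    have entry: "(W * F (Suc k) - of_nat (s * t) \<cdot>\<^sub>m F k) $$ (i, j) =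
      of_nat (card {x \<in> P. dist_G ?u x = 2 \<and> dist_G x ?v \<le> 2 * Suc k})
      + (1 - of_nat s) * (if r \<le> Suc k then 1 else 0) - of_nat (s * t) * (if r \<le> k then 1 else 0)"
      using WF [OF ij, of "Suc k"] ij F [of k] W r by (auto simp: F_def)
    have Fe: "F (Suc (Suc k)) $$ (i, j) = (if r \<le> Suc (Suc k) then 1 else 0)"
      using ij r by (auto simp: F_def)
    \<comment> \<open>The counts are \<open>s * (t + 1)\<close>, \<open>s\<close>, 1 and 0. The
      entries become \<open>s * (t + 1) + (1 - s) - s * t = 1\<close>,
      \<open>s + (1 - s) = 1\<close>, 1 and 0.\<close>
    consider "r \<le> k" | "r = Suc k" | "r = Suc (Suc k)" | "r > Suc (Suc k)" by linarith
    then show "F (Suc (Suc k)) $$ (i, j) = (W * F (Suc k) - of_nat (s * t) \<cdot>\<^sub>m F k) $$ (i, j)"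
    proof cases
      case 1
      have "card {x \<in> P. dist_G ?u x = 2 \<and> dist_G x ?v \<le> 2 * Suc k} = s * (t + 1)"
      proof (rule card_collinear_all [OF uv(1)])
        fix x assume "x \<in> P" "dist_G ?u x = 2"
        then show "dist_G x ?v \<le> 2 * Suc k" using distance_triangle_2(2) [OF uv(1) _ _ uv(3)] r(2) 1 by fastforce
      qed
      then show ?thesis unfolding entry Fe using 1 by (simp add: algebra_simps)
    next
      case 2
      then have "card {x \<in> P. dist_G ?u x = 2 \<and> dist_G x ?v \<le> 2 * Suc k} = s"
        using card_collinear_same [OF uv(1,2), of "Suc k"] r(2) that by simp
      then show ?thesis unfolding entry Fe using 2 by simp
    next
      case 3
      then have "card {x \<in> P. dist_G ?u x = 2 \<and> dist_G x ?v \<le> 2 * Suc k} = 1"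
        using card_collinear_next [OF uv(1,2), of "Suc k"] r(2) that by simp
      then show ?thesis unfolding entry Fe using 3 by simp
    next
      case 4
      have "{x \<in> P. dist_G ?u x = 2 \<and> dist_G x ?v \<le> 2 * Suc k} = {}"
        using distance_triangle_2(1) [OF uv(1) _ _ uv(3)] r(2) 4 by fastforce
      then have "card {x \<in> P. dist_G ?u x = 2 \<and> dist_G x ?v \<le> 2 * Suc k} = 0" by (simp only: card.empty)
      then show ?thesis unfolding entry Fe using 4 by simp
    qed
  qed (use W in \<open>auto simp: F_def\<close>)
  have F_0: "F 0 = 1\<^sub>m m" by (rule eq_matI) (use f_self in \<open>auto simp: F_def\<close>)
  have F_1: "F (Suc 0) = W + of_nat s \<cdot>\<^sub>m 1\<^sub>m m"
  proof (rule eq_matI)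
    fix i j assume "i < dim_row (W + of_nat s \<cdot>\<^sub>m 1\<^sub>m m)" "j < dim_col (W + of_nat s \<cdot>\<^sub>m 1\<^sub>m m)"
    then have ij: "i < m" "j < m" by auto
    obtain r where "dist_G (f i) (f j) = 2 * r" using distance_P_le fP ij by blast
    then show "F (Suc 0) $$ (i, j) = (W + of_nat s \<cdot>\<^sub>m 1\<^sub>m m) $$ (i, j)"
      using ij f_self [OF ij] by (cases "r = 0 \<or> r = 1") (auto simp: F_def W_def)
  qed (use F in auto)
  have G: "mat_chebG (of_nat (s * t)) (of_nat s) W k = F k" if "k \<le> D" for k
    using that
  proof (induction k rule: induct_nat_012)
    case 0
    show ?case using W F_0 by simp
  next
    case 1
    show ?case using W F_1 by simp
  next
    case (ge2 k)
    then show ?case using rec [of k] by simp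
  qed
  show ?thesis
  proof (rule mat_chebG_bound [OF W])
    show "m > 0" using nondegenerate(1) finite_P by (simp add: m_def card_gt_0_iff)
    show "(\<Sum>j<m. mat_chebG (of_nat (s * t)) (of_nat s) W i $$ (j, j)) = of_nat m" if "i \<le> D" for i
    proof -
      have "F i $$ (j, j) = 1" if "j < m" for j using that f_self [of j j] by (simp add: F_def)
      then show ?thesis unfolding G [OF that] by simp
    qed
    \<comment> \<open>\<open>F D\<close> is the all-ones matrix, and each row of \<open>W\<close>
      has sum \<open>s * (t + 1) + 1 - s\<close>.\<close>
    have "W * F D = of_nat (1 + s * t) \<cdot>\<^sub>m F D"
    proof (rule eq_matI)
      fix i j assume "i < dim_row ((of_nat (1 + s * t) :: complex) \<cdot>\<^sub>m F D)"
        "j < dim_col ((of_nat (1 + s * t) :: complex) \<cdot>\<^sub>m F D)"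
      then have ij: "i < m" "j < m" using F [of D] by auto
      have le: "dist_G x (f j) \<le> 2 * D" if "x \<in> P" for x using distance_P_le [of x "f j"] fP ij that by auto
      have "card {x \<in> P. dist_G (f i) x = 2 \<and> dist_G x (f j) \<le> 2 * D} = s * (t + 1)"
        using le by (intro card_collinear_all fP ij)
      then show "(W * F D) $$ (i, j) = (of_nat (1 + s * t) \<cdot>\<^sub>m F D) $$ (i, j)"
        using WF [OF ij, of D] ij le [OF fP [OF ij(1)]] by (simp add: F_def algebra_simps)
    qed (use W in \<open>auto simp: F_def\<close>)
    then show "W * mat_chebG (of_nat (s * t)) (of_nat s) W D
        = of_nat (1 + s * t) \<cdot>\<^sub>m mat_chebG (of_nat (s * t)) (of_nat s) W D"
      using G [of D] by simp
  qed (use nondegenerate in auto)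
qed

end

section \<open>From eccentricities and girth to a Moore geometry\<close>

text \<open>Two vertices \<open>L\<close> and \<open>M\<close> at distance \<open>d\<close> both lie
  in \<open>Q\<close>, which makes \<open>d\<close> even. Comparing the neighbours of
  \<open>L\<close> with those of a neighbour \<open>p\<close> of \<open>M\<close> gives
  \<open>s < t\<close>.\<close>

lemma (in bipartite_pair_graph) eccentricity_girth_bound:
  assumes Q: "Q \<noteq> {}" and ecc_P: "\<And>p. p \<in> P \<Longrightarrow> eccentricity G p = e"
    and ecc_Q: "\<And>q. q \<in> Q \<Longrightarrow> eccentricity G q = d" and "e < d"
    and girth: "girth G = enat (2 * d - 2)"
    and deg_P: "\<And>p p'. p \<in> P \<Longrightarrow> p' \<in> P \<Longrightarrow> card (nbr p) = card (nbr p')"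
    and deg_Q: "\<And>q q'. q \<in> Q \<Longrightarrow> q' \<in> Q \<Longrightarrow> card (nbr q) = card (nbr q')"
  shows "even d \<and> 4 \<le> d \<and> d \<le> 26"
proof -
  \<comment> \<open>As counted cycles have length at least 3, the subtraction in
    \<open>2 * d - 2\<close> is not truncated.\<close>
  have d3: "d \<ge> 3" using girth_ge_3 girth by simp
  obtain L where L: "L \<in> Q" using Q by blast
  then have LV: "L \<in> pverts G" using classes by blast
  obtain M where M: "M \<in> pverts G" "dist_G L M = d"
    using eccentricity_attained [OF LV] ecc_Q [OF L] by metis
  have dM: "dist_G M L = d" using distance_sym LV M by metis
  obtain p where p: "(M, p) \<in> parcs G" "dist_G p L = d - 1"
    using distance_closer [OF M(1) LV, of "d - 1"] dM d3 by auto
  have far: "dist_G u v \<le> e" if "u \<in> P" "v \<in> pverts G" for u v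
    using distance_le_eccentricity [OF that(2), of u] ecc_P [OF that(1)] by simp
  have MQ: "M \<in> Q"
    using far [of M L] M(1) LV dM \<open>e < d\<close> classes by fastforce
  then have pP: "p \<in> P" "p \<in> pverts G" using p(1) classes by blast+
  have e: "e = d - 1" using eccentricity_arc [OF p(1)] ecc_Q [OF MQ] ecc_P [OF pP(1)] \<open>e < d\<close> by simp
  have "even d" using distance_parity [OF LV M(1)] M(2) L MQ classes by blast
  then obtain h where "d = 2 * h" by blast
  then have "d = 2 * (h - 1) + 2" "h - 1 > 0" using d3 by auto
  then obtain D where D: "d = 2 * D + 2" "D > 0" by blast
  \<comment> \<open>The girth is \<open>4 * D + 2\<close>, while the cycle in question has length at
    most \<open>4 * D\<close>.\<close>
  have unique: "y = y'"
    if "(x, y) \<in> parcs G" "(x, y') \<in> parcs G" "v \<in> pverts G"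
      "dist_G x v = Suc k" "dist_G y v = k" "dist_G y' v = k" "Suc k \<le> 2 * D" for x y y' v k
    using closer_neighbour_unique [OF that(1-6)] that(7) by (simp add: girth D)
  define s where "s = card (nbr L) - 1"
  define t where "t = card (nbr p) - 1"
  \<comment> \<open>\<open>l\<close> has two neighbours, at distances \<open>2 * D + 1\<close> and
    \<open>2 * D - 1\<close> from \<open>L\<close>; this gives \<open>s > 0\<close>.\<close>
  obtain l where l: "(p, l) \<in> parcs G" "dist_G l L = 2 * D"
    using distance_closer [OF pP(2) LV, of "2 * D"] p(2) D by auto
  then have lV: "l \<in> pverts G" "l \<in> Q" using arc_verts pP classes by blast+
  obtain x where x: "(l, x) \<in> parcs G" "dist_G x L = 2 * D - 1"
    using distance_closer [OF lV(1) LV, of "2 * D - 1"] l(2) D by auto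
  have "x \<noteq> p" using x(2) p(2) D by auto
  then have "card {x, p} \<le> card (nbr l)" using x(1) l(1) sym_arc finite_nbr by (intro card_mono) auto
  then have "card (nbr L) \<ge> 2" using \<open>x \<noteq> p\<close> deg_Q [OF L lV(2)] by simp
  then have s: "s > 0" "card (nbr L) = s + 1" by (auto simp: s_def)
  \<comment> \<open>Each neighbour \<open>y\<close> of \<open>L\<close> is at distance
    \<open>2 * D\<close> from \<open>p\<close>. The first step from \<open>p\<close> towards
    \<open>y\<close> defines an injection into the neighbours of \<open>p\<close>. Its values lie at
    distance \<open>2 * D\<close> from \<open>L\<close>, so it misses \<open>M\<close>, and
    \<open>s + 1 \<le> t\<close>.\<close>
  have "\<exists>m. (p, m) \<in> parcs G \<and> dist_G m y = 2 * D - 1" if y: "y \<in> nbr L" for y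
  proof -
    have yV: "y \<in> pverts G" "y \<in> P" using y arc_verts L classes by blast+
    have "dist_G y p = 2 * D"
      using distance_nbr [of L y p] y pP(2) p(2) far [OF yV(2) pP(2)] distance_sym [OF LV pP(2)] D e by auto
    then have "dist_G p y = Suc (2 * D - 1)" using distance_sym yV pP D by simp
    then show ?thesis using distance_closer [OF pP(2) yV(1)] by metis
  qed
  then obtain g where g: "\<And>y. y \<in> nbr L \<Longrightarrow> (p, g y) \<in> parcs G \<and> dist_G (g y) y = 2 * D - 1" by metis
  have gL: "dist_G (g y) L = 2 * D" if y: "y \<in> nbr L" for y
  proof -
    have gV: "g y \<in> pverts G" using g [OF y] arc_verts by blast
    have "dist_G L (g y) = 2 * D \<or> dist_G L (g y) + 1 = 2 * D - 1"
      using distance_nbr [of L y "g y"] y gV g [OF y] distance_sym [of y "g y"] arc_verts D by fastforce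
    moreover have "dist_G (g y) L = 2 * D + 2 \<or> dist_G (g y) L = 2 * D"
      using distance_nbr [of p "g y" L] g [OF y] LV p(2) D by auto
    ultimately show ?thesis using distance_sym [OF LV gV] by auto
  qed
  have "inj_on g (nbr L)"
  proof (rule inj_onI)
    fix y y' assume y: "y \<in> nbr L" "y' \<in> nbr L" "g y = g y'"
    have V: "g y \<in> pverts G" "y \<in> pverts G" "y' \<in> pverts G" using g [OF y(1)] y arc_verts by blast+
    show "y = y'"
    proof (rule unique)
      show "(L, y) \<in> parcs G" "(L, y') \<in> parcs G" "g y \<in> pverts G" using y V by auto
      show "dist_G L (g y) = Suc (2 * D - 1)" using gL [OF y(1)] distance_sym [OF LV V(1)] D by simp
      show "dist_G y (g y) = 2 * D - 1" "dist_G y' (g y) = 2 * D - 1"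
        using g [OF y(1)] g [OF y(2)] y(3) distance_sym V by metis+
    qed (use D in simp)
  qed
  then have "card (nbr L) = card (g ` nbr L)" by (simp add: card_image)
  also have "\<dots> \<le> card (nbr p - {M})"
    using g gL dM D finite_nbr by (intro card_mono) auto
  also have "\<dots> = card (nbr p) - 1"
    using p(1) sym_arc finite_nbr by (subst card_Diff_singleton) auto
  finally have st: "s < t" using s by (simp add: t_def)
  interpret bipartite_moore_graph G P Q s t D
  proof unfold_locales
    show "card (nbr u) = t + 1" if "u \<in> P" for u
      using deg_P [OF that pP(1)] st by (simp add: t_def)
    show "card (nbr u) = s + 1" if "u \<in> Q" for u using deg_Q [OF that L] s by simp
    show "dist_G u v \<le> 2 * D + 1" if "u \<in> P" "v \<in> pverts G" for u v
      using far [OF that] e D by simp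
    show "s * t \<noteq> 1" using st s by simp
  qed (use pP s st D unique in auto)
  show ?thesis using half_diameter_bound D \<open>even d\<close> by simp
qed

theorem mainTheorem1:
  fixes G :: "'a pair_pre_digraph" and d :: nat
  assumes "distance_biregular G"
    and "diameter G = d"
    and "girth G = enat (2 * d - 2)"
    and "card (eccentricity G ` pverts G) = 2"
  shows "even d \<and> (4 \<le> d \<and> d \<le> 26 \<or> d \<in> {48, 50})"
proof -
  interpret connected_pair_graph G
    using assms(1) by (simp add: distance_biregular_def connected_pair_graph_def connected_pair_graph_axioms_def)
  obtain A B b c where AB: "bipartition G A B" and
    reg: "\<And>X u i v. X \<in> {A, B} \<Longrightarrow> u \<in> X \<Longrightarrow> i \<le> eccentricity G u \<Longrightarrow> v \<in> sphere G i u \<Longrightarrow>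
      card (sphere G (i + 1) u \<inter> sphere G 1 v) = b X i"
    using assms(1) unfolding distance_biregular_def by (metis (no_types, lifting))
  note bip = AB [unfolded bipartition_def]
  let ?nbr = "\<lambda>u. {w. (u, w) \<in> parcs G}"
  have d3: "d \<ge> 3" using girth_ge_3 assms(3) by simp
  \<comment> \<open>If two eccentricities in a class differed, \<open>b X\<close> at the smaller one
    would be 0 because of one vertex and positive because of a geodesic from the other.\<close>
  have ecc_const: "eccentricity G u = eccentricity G u'" if X: "X \<in> {A, B}" "u \<in> X" "u' \<in> X" for X u u'
  proof -
    have False if uu: "u \<in> X" "u' \<in> X" and lt: "eccentricity G u < eccentricity G u'" for u u'
    proof -
      let ?e = "eccentricity G u"
      have V: "u \<in> pverts G" "u' \<in> pverts G" using X(1) uu bip by blast+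
      obtain v where v: "v \<in> pverts G" "dist_G u v = ?e" using eccentricity_attained [OF V(1)] .
      have "sphere G (?e + 1) u = {}"
        using distance_le_eccentricity [of _ u] by (fastforce simp: sphere_def)
      then have b0: "b X ?e = 0" using reg [OF X(1) uu(1) order_refl, of v] v by (simp add: sphere_def [of G ?e])
      obtain z where z: "z \<in> pverts G" "dist_G u' z = eccentricity G u'" using eccentricity_attained [OF V(2)] .
      let ?n = "eccentricity G u'"
      obtain f where f: "f 0 = z" "\<forall>j\<le>?n. f j \<in> pverts G \<and> dist_G (f j) u' = ?n - j"
        "\<forall>j<?n. (f j, f (Suc j)) \<in> parcs G"
        using geodesic [OF z(1) V(2)] distance_sym [OF z(1) V(2)] z(2) by metis
      \<comment> \<open>\<open>f\<close> descends from \<open>z\<close> to \<open>u'\<close>, so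
        index \<open>j\<close> lies at distance \<open>?e\<close> from \<open>u'\<close> and
        \<open>j - 1\<close> one step farther.\<close>
      define j where "j = ?n - ?e"
      have j: "0 < j" "j \<le> ?n" "?n - j = ?e" "?n - (j - 1) = ?e + 1" using lt by (auto simp: j_def)
      have "f j \<in> pverts G" "f (j - 1) \<in> pverts G"
        "dist_G (f j) u' = ?e" "dist_G (f (j - 1)) u' = ?e + 1"
        using f(2) [rule_format, of j] f(2) [rule_format, of "j - 1"] j by simp_all
      then have w: "f j \<in> sphere G ?e u'" "f (j - 1) \<in> sphere G (?e + 1) u'"
        using distance_sym [OF V(2)] by (simp_all add: sphere_def)
      have "(f (j - 1), f j) \<in> parcs G" using f(3) [rule_format, of "j - 1"] j by simp
      then have "f (j - 1) \<in> sphere G 1 (f j)" using sphere_1 sym_arc arc_verts by blast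
      then have "sphere G (?e + 1) u' \<inter> sphere G 1 (f j) \<noteq> {}" using w(2) by blast
      moreover have "finite (sphere G (?e + 1) u' \<inter> sphere G 1 (f j))"
        using pair_finite_verts by (simp add: sphere_def)
      ultimately have "b X ?e > 0"
        using reg [OF X(1) uu(2), of ?e "f j"] w(1) lt by (metis card_gt_0_iff less_imp_le)
      then show False using b0 by simp
    qed
    then show ?thesis using X by (metis linorder_neqE_nat)
  qed
  have deg_const: "card (nbr u) = card (nbr u')" if X: "X \<in> {A, B}" "u \<in> X" "u' \<in> X" for X u u'
  proof -
    \<comment> \<open>For \<open>i = 0\<close> and \<open>v = u\<close> both spheres are the
      neighbourhood of \<open>u\<close>.\<close>
    have "card (nbr u) = b X 0" if "u \<in> X" for u
    proof -
      have "u \<in> pverts G" using X(1) that bip by blast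
      then show ?thesis using reg [OF X(1) that, of 0 u] sphere_1 by (simp add: sphere_def)
    qed
    then show ?thesis using X by metis
  qed
  obtain p q where pq: "p \<in> A" "q \<in> B" using bip by blast
  have ecc: "eccentricity G ` pverts G = {eccentricity G p, eccentricity G q}"
  proof -
    have "eccentricity G ` A = {eccentricity G p}" "eccentricity G ` B = {eccentricity G q}"
      using ecc_const pq by blast+
    then show ?thesis using bip by (metis image_Un insert_is_Un)
  qed
  then have ne: "eccentricity G p \<noteq> eccentricity G q" using assms(4) by auto
  have d: "d = max (eccentricity G p) (eccentricity G q)"
    using assms(2) unfolding diameter_def ecc by simp
  \<comment> \<open>The class of larger eccentricity takes the role of \<open>Q\<close>. The first
    alternative of the conclusion always holds.\<close>
  have "even d \<and> 4 \<le> d \<and> d \<le> 26"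
  proof (cases "eccentricity G p < eccentricity G q")
    case True
    interpret bipartite_pair_graph G A B by unfold_locales (use bip in auto)
    show ?thesis
    proof (rule eccentricity_girth_bound [of "eccentricity G p"])
      show "B \<noteq> {}" using pq by blast
      show "eccentricity G u = eccentricity G p" if "u \<in> A" for u
        by (rule ecc_const [of A]) (use that pq in auto)
      show "eccentricity G u = d" if "u \<in> B" for u
      proof -
        have "eccentricity G u = eccentricity G q" by (rule ecc_const [of B]) (use that pq in auto)
        then show ?thesis using True d by simp
      qed
      show "eccentricity G p < d" using True d by simp
      show "girth G = enat (2 * d - 2)" by fact
      show "card (nbr u) = card (nbr u')" if "u \<in> A" "u' \<in> A" for u u'
        by (rule deg_const [of A]) (use that in auto)
      show "card (nbr u) = card (nbr u')" if "u \<in> B" "u' \<in> B" for u u'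
        by (rule deg_const [of B]) (use that in auto)
    qed
  next
    case False
    interpret bipartite_pair_graph G B A by unfold_locales (use bip in auto)
    show ?thesis
    proof (rule eccentricity_girth_bound [of "eccentricity G q"])
      show "A \<noteq> {}" using pq by blast
      show "eccentricity G u = eccentricity G q" if "u \<in> B" for u
        by (rule ecc_const [of B]) (use that pq in auto)
      show "eccentricity G u = d" if "u \<in> A" for u
      proof -
        have "eccentricity G u = eccentricity G p" by (rule ecc_const [of A]) (use that pq in auto)
        then show ?thesis using False ne d by simp
      qed
      show "eccentricity G q < d" using False ne d by simp
      show "girth G = enat (2 * d - 2)" by fact
      show "card (nbr u) = card (nbr u')" if "u \<in> B" "u' \<in> B" for u u'
        by (rule deg_const [of B]) (use that in auto)
      show "card (nbr u) = card (nbr u')" if "u \<in> A" "u' \<in> A" for u u'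
        by (rule deg_const [of A]) (use that in auto)
    qed
  qed
  then show ?thesis by blast
qed

end
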